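(* None of the elliptic stationary solutions of the focusing NLS equation is spectrally stable, with unstable spectrum near the origin for any choice of the parameters: for all $0\le k<1$ and $k^2\le b\le 1$, if $\phi$ is the elliptic stationary solution with parameters $(k,b)$, then for every $\epsilon>0$ there exists $\lambda\in\sigma_{\mathcal L}$ with $|\lambda|<\epsilon$ and $\operatorname{Re}\lambda>0$.
   Context: The focusing NLS equation is $i\Psi_t+\tfrac12\Psi_{xx}+\Psi|\Psi|^2=0$. Stationary solutions are $\Psi=e^{-i\omega t}\phi(x)$. For $0\le k<1$, $k^2\le b\le1$, the elliptic solution with parameters $(k,b)$ is $\phi(x)=R(x)e^{i\theta(x)}$ with $$R^2(x)=b-k^2\operatorname{sn}^2(x,k),\quad \omega=\tfrac12(1+k^2)-\tfrac32 b,\quad c=\sqrt{b(1-b)(b-k^2)},\quad \theta(x)=\int_0^x\frac{c}{R^2(y)}\,dy,$$ where $\operatorname{sn},\operatorname{cn}$ are Jacobi elliptic functions of modulus $k$. For $b>k^2$, $R>0$ is the positive root; for $b=k^2$ (then $c=0$) one takes the smooth function $R(x)=k\operatorname{cn}(x,k)$ and $\theta=0$, and all terms below containing $c$ vanish. The linearization about $\phi$, writing $\Psi=e^{-i\omega t}e^{i\theta}(R+\epsilon(u+iv)+\dots)$, is $\partial_t(u,v)^T=\mathcal L(u,v)^T$ with $$\mathcal L=\begin{pmatrix}-S&\mathcal L_-\\-\mathcal L_+&-S\end{pmatrix},\quad \mathcal L_-=-\tfrac12\partial_x^2-R^2-\omega+\frac{c^2}{2R^4},\quad \mathcal L_+=-\tfrac12\partial_x^2-3R^2-\omega+\frac{c^2}{2R^4},\quad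 S=\frac{c}{R^2}\partial_x-\frac{cR'}{R^3}.$$ $\sigma_{\mathcal L}$ is the set of $\lambda\in\mathbb C$ for which $\mathcal L(U,V)^T=\lambda(U,V)^T$ has a nonzero solution $(U,V)$ (complex-valued) that is bounded on $\mathbb R$. Spectral stability means $\sigma_{\mathcal L}$ does not enter the open right half plane.
   Formalization: The formal theorem assumes in addition that φ is not identically zero, which excludes only k = b = 0; there φ = 0, the spectrum of 𝓛 is purely imaginary, and the claim as stated fails. *)

theory Defs
  imports "HOL-Analysis.Analysis"
begin

text \<open>
  Jacobi elliptic functions of modulus \<open>k\<close> (\<open>0 \<le> k < 1\<close>). For such \<open>k\<close> the incomplete elliptic
  integral of the first kind is an increasing bijection of the real line, so that its inverse,
  the amplitude, is well defined.
\<close>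

definition elliptic_F :: "real \<Rightarrow> real \<Rightarrow> real" where
  "elliptic_F \<phi> k = (LBINT t=0..\<phi>. 1 / sqrt (1 - k\<^sup>2 * (sin t)\<^sup>2))"

definition jacobi_am :: "real \<Rightarrow> real \<Rightarrow> real" where
  "jacobi_am x k = (THE \<phi>. elliptic_F \<phi> k = x)"

definition jacobi_sn :: "real \<Rightarrow> real \<Rightarrow> real" where
  "jacobi_sn x k = sin (jacobi_am x k)"

definition jacobi_cn :: "real \<Rightarrow> real \<Rightarrow> real" where
  "jacobi_cn x k = cos (jacobi_am x k)"

text \<open>
  The elliptic solution \<open>R(x) exp(i \<theta>(x))\<close> of the stationary problem for
  \<open>i \<Psi>\<^sub>t + \<Psi>\<^sub>x\<^sub>x/2 + \<Psi>|\<Psi>|\<^sup>2 = 0\<close>, \<open>\<Psi> = exp(-i \<omega> t) \<phi>(x)\<close>. If \<open>b = k\<^sup>2\<close>, then \<open>ell_c k b = 0\<close>; as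
  \<open>0 / r = 0\<close> for every \<open>r\<close> (also \<open>r = 0\<close>), all terms below that contain \<open>ell_c\<close> vanish in that
  case, even at the zeros of \<open>ell_R\<close>.
\<close>

definition ell_R :: "real \<Rightarrow> real \<Rightarrow> real \<Rightarrow> real" where
  "ell_R k b x =
    (if b = k\<^sup>2 then k * jacobi_cn x k else sqrt (b - k\<^sup>2 * (jacobi_sn x k)\<^sup>2))"

definition ell_omega :: "real \<Rightarrow> real \<Rightarrow> real" where
  "ell_omega k b = 1/2 * (1 + k\<^sup>2) - 3/2 * b"

definition ell_c :: "real \<Rightarrow> real \<Rightarrow> real" where
  "ell_c k b = sqrt (b * (1 - b) * (b - k\<^sup>2))"

definition ell_theta :: "real \<Rightarrow> real \<Rightarrow> real \<Rightarrow> real" where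
  "ell_theta k b x = (LBINT y=0..x. ell_c k b / (ell_R k b y)\<^sup>2)"

definition elliptic_solution :: "real \<Rightarrow> real \<Rightarrow> real \<Rightarrow> complex" where
  "elliptic_solution k b x = complex_of_real (ell_R k b x) * exp (\<i> * complex_of_real (ell_theta k b x))"

abbreviation Dx :: "(real \<Rightarrow> complex) \<Rightarrow> real \<Rightarrow> complex" where
  "Dx f \<equiv> (\<lambda>x. vector_derivative f (at x))"

definition L_minus :: "real \<Rightarrow> real \<Rightarrow> (real \<Rightarrow> complex) \<Rightarrow> real \<Rightarrow> complex" where
  "L_minus k b f x = - (1/2) * Dx (Dx f) x
    + complex_of_real (- (ell_R k b x)\<^sup>2 - ell_omega k b + (ell_c k b)\<^sup>2 / (2 * ell_R k b x ^ 4)) * f x"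

definition L_plus :: "real \<Rightarrow> real \<Rightarrow> (real \<Rightarrow> complex) \<Rightarrow> real \<Rightarrow> complex" where
  "L_plus k b f x = - (1/2) * Dx (Dx f) x
    + complex_of_real (- 3 * (ell_R k b x)\<^sup>2 - ell_omega k b + (ell_c k b)\<^sup>2 / (2 * ell_R k b x ^ 4)) * f x"

definition S_op :: "real \<Rightarrow> real \<Rightarrow> (real \<Rightarrow> complex) \<Rightarrow> real \<Rightarrow> complex" where
  "S_op k b f x = complex_of_real (ell_c k b / (ell_R k b x)\<^sup>2) * Dx f x
    - complex_of_real (ell_c k b * deriv (ell_R k b) x / ell_R k b x ^ 3) * f x"

definition linearization ::
  "real \<Rightarrow> real \<Rightarrow> (real \<Rightarrow> complex) \<times> (real \<Rightarrow> complex) \<Rightarrow> (real \<Rightarrow> complex) \<times> (real \<Rightarrow> complex)" where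
  "linearization k b = (\<lambda>(U, V).
    (\<lambda>x. - S_op k b U x + L_minus k b V x, \<lambda>x. - L_plus k b U x - S_op k b V x))"

definition twice_differentiable :: "(real \<Rightarrow> complex) \<Rightarrow> bool" where
  "twice_differentiable f \<longleftrightarrow> f differentiable_on UNIV \<and> Dx f differentiable_on UNIV"

definition stability_spectrum :: "real \<Rightarrow> real \<Rightarrow> complex set" where
  "stability_spectrum k b = {\<mu>. \<exists>U V. twice_differentiable U \<and> twice_differentiable V \<and>
    bounded (range U) \<and> bounded (range V) \<and> (U, V) \<noteq> (\<lambda>x. 0, \<lambda>x. 0) \<and>
    linearization k b (U, V) = (\<lambda>x. \<mu> * U x, \<lambda>x. \<mu> * V x)}"

definition spectrally_stable :: "real \<Rightarrow> real \<Rightarrow> bool" where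
  "spectrally_stable k b \<longleftrightarrow> stability_spectrum k b \<inter> {\<mu>. Re \<mu> > 0} = {}"

text \<open>
  The parameter range contains exactly one point, \<open>k = b = 0\<close>, for which the elliptic solution is
  the zero function. The zero solution is spectrally stable (its spectrum is imaginary).
\<close>

lemma elliptic_F_strict_mono:
  assumes "0 \<le> k" "k < 1"
  shows "strict_mono (\<lambda>\<phi>. elliptic_F \<phi> k)"
proof (rule strict_monoI)
  fix x y :: real assume xy: "x < y"
  let ?g = "\<lambda>t. 1 / sqrt (1 - k\<^sup>2 * (sin t)\<^sup>2)"
  have k2: "k\<^sup>2 < 1" using assms by (simp add: power_less_one_iff)
  have pos: "1 - k\<^sup>2 * (sin t)\<^sup>2 > 0" for t
  proof -
    have "k\<^sup>2 * (sin t)\<^sup>2 \<le> k\<^sup>2 * 1"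
      by (rule mult_left_mono) (auto simp: abs_square_le_1)
    with k2 show ?thesis by linarith
  qed
  have cont: "continuous_on A ?g" for A
    using less_imp_neq[OF pos, symmetric] by (intro continuous_intros) simp_all
  have ge1: "?g t \<ge> 1" for t
  proof -
    have "sqrt (1 - k\<^sup>2 * (sin t)\<^sup>2) \<le> 1" by simp
    moreover have "sqrt (1 - k\<^sup>2 * (sin t)\<^sup>2) > 0" using pos[of t] by simp
    ultimately show ?thesis by simp
  qed
  define a c where "a = min 0 x - 1" and "c = max 0 y + 1"
  define G where "G = (\<lambda>u. LBINT t=0..u. ?g t)"
  have der: "(G has_real_derivative ?g u) (at u)" if "u \<in> {x..y}" for u
  proof -
    have "((\<lambda>u. LBINT t=0..u. ?g t) has_vector_derivative ?g u) (at u within {a..c})"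
      using interval_integral_FTC2[of a 0 c ?g u, OF _ _ cont] that xy
      by (auto simp: a_def c_def zero_ereal_def)
    moreover have "u \<in> interior {a..c}" using that by (auto simp: a_def c_def)
    ultimately show ?thesis
      unfolding G_def has_real_derivative_iff_has_vector_derivative
      by (metis at_within_interior)
  qed
  have "G x < G y"
  proof (rule DERIV_pos_imp_increasing[OF xy])
    fix u assume "x \<le> u" "u \<le> y"
    then show "\<exists>d. DERIV G u :> d \<and> d > 0"
      using der[of u] ge1[of u] by (metis atLeastAtMost_iff less_le_trans zero_less_one)
  qed
  then show "elliptic_F x k < elliptic_F y k"
    unfolding G_def elliptic_F_def .
qed

lemma jacobi_am_0:
  assumes "0 \<le> k" "k < 1"
  shows "jacobi_am 0 k = 0"
proof -
  have 0: "elliptic_F 0 k = 0"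
    by (simp add: elliptic_F_def flip: zero_ereal_def)
  have "elliptic_F \<phi> k = 0 \<longleftrightarrow> \<phi> = 0" for \<phi>
    using strict_mono_eq[OF elliptic_F_strict_mono[OF assms], of \<phi> 0] 0 by simp
  then show ?thesis by (simp add: jacobi_am_def)
qed

lemma elliptic_solution_eq_0_iff:
  assumes "0 \<le> k" "k < 1" "k\<^sup>2 \<le> b"
  shows "elliptic_solution k b = (\<lambda>x. 0) \<longleftrightarrow> k = 0 \<and> b = 0"
proof
  assume "elliptic_solution k b = (\<lambda>x. 0)"
  then have "ell_R k b 0 = 0"
    unfolding elliptic_solution_def by (metis exp_not_eq_zero mult_eq_0_iff of_real_eq_0_iff)
  then show "k = 0 \<and> b = 0"
    using assms by (auto simp: ell_R_def jacobi_cn_def jacobi_sn_def jacobi_am_0 split: if_splits)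
next
  assume "k = 0 \<and> b = 0"
  then show "elliptic_solution k b = (\<lambda>x. 0)"
    by (simp add: elliptic_solution_def ell_R_def fun_eq_iff)
qed

end

theory Submission
  imports Defs "HOL-Complex_Analysis.Complex_Analysis"
begin

text \<open>
  The linearization has eigenfunctions that are quadratic in the solutions of the Lax pair: on the
  curve \<open>\<Omega>\<^sup>2 = P(\<zeta>)\<close> (a quartic \<open>P\<close>), the value \<open>\<lambda> = 2 \<Omega>\<close> has the eigenfunction built from
  \<open>f = B exp(2 \<Omega> \<integral> R / B)\<close>, and it is bounded as soon as \<open>Re (\<Omega> J(\<zeta>)) = 0\<close>, where \<open>J(\<zeta>)\<close> is the integral
  of \<open>R / B\<close> over a period. At a root \<open>\<zeta>0\<close> of \<open>P\<close> one has \<open>\<Omega> = 0\<close>. With \<open>w = R\<^sup>2\<close> and \<open>e0 = 2 \<zeta>0\<^sup>2 - \<omega>\<close>,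
  integration by parts gives \<open>P'(\<zeta>0) J(\<zeta>0) = \<integral> (w - e0)\<close>, which shows that \<open>J(\<zeta>0)\<close> is not real for a
  suitable root. Solving \<open>\<Omega> J(\<zeta>) = i t\<close>, i.e. \<open>P(\<zeta>) J(\<zeta>)\<^sup>2 = - t\<^sup>2\<close>, near \<open>\<zeta>0\<close> for small real \<open>t\<close> of the
  right sign then gives \<open>\<lambda> = 2 i t / J(\<zeta>)\<close>, close to zero and with positive real part.
\<close>

section \<open>Jacobi elliptic functions\<close>

lemma elliptic_modulus_pos:
  fixes k t :: real
  assumes "0 \<le> k" "k < 1"
  shows "1 - k\<^sup>2 * (sin t)\<^sup>2 > 0"
proof -
  have "k\<^sup>2 < 1" using assms by (simp add: power_less_one_iff)
  moreover have "k\<^sup>2 * (sin t)\<^sup>2 \<le> k\<^sup>2 * 1"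
    by (rule mult_left_mono) (auto simp: abs_square_le_1)
  ultimately show ?thesis by linarith
qed

lemma elliptic_F_has_real_derivative:
  assumes "0 \<le> k" "k < 1"
  shows "((\<lambda>\<phi>. elliptic_F \<phi> k) has_real_derivative 1 / sqrt (1 - k\<^sup>2 * (sin u)\<^sup>2)) (at u)"
proof -
  let ?g = "\<lambda>t. 1 / sqrt (1 - k\<^sup>2 * (sin t)\<^sup>2)"
  define a c where "a = min 0 u - 1" and "c = max 0 u + 1"
  have cont: "continuous_on A ?g" for A
    using less_imp_neq[OF elliptic_modulus_pos[OF assms], symmetric]
    by (intro continuous_intros) simp_all
  have "((\<lambda>u. LBINT t=0..u. ?g t) has_vector_derivative ?g u) (at u within {a..c})"
    using interval_integral_FTC2[of a 0 c ?g u, OF _ _ cont]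
    by (auto simp: a_def c_def zero_ereal_def)
  moreover have "u \<in> interior {a..c}" by (auto simp: a_def c_def)
  ultimately show ?thesis
    unfolding elliptic_F_def has_real_derivative_iff_has_vector_derivative
    by (metis at_within_interior)
qed

lemma elliptic_F_0 [simp]: "elliptic_F 0 k = 0"
  by (simp add: elliptic_F_def flip: zero_ereal_def)

text \<open>The integrand is at least 1, so \<open>elliptic_F \<phi> k - \<phi>\<close> is
  nondecreasing in \<open>\<phi>\<close>. Surjectivity and the positive period rest on this.\<close>

lemma elliptic_F_expands:
  assumes "0 \<le> k" "k < 1" "x \<le> y"
  shows "y - x \<le> elliptic_F y k - elliptic_F x k"
proof -
  have "(\<lambda>\<phi>. elliptic_F \<phi> k - \<phi>) x \<le> (\<lambda>\<phi>. elliptic_F \<phi> k - \<phi>) y"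
  proof (rule DERIV_nonneg_imp_nondecreasing[OF assms(3)])
    fix u :: real
    have "0 < sqrt (1 - k\<^sup>2 * (sin u)\<^sup>2)" "sqrt (1 - k\<^sup>2 * (sin u)\<^sup>2) \<le> 1"
      using elliptic_modulus_pos[OF assms(1,2), of u] by simp_all
    then have "1 / sqrt (1 - k\<^sup>2 * (sin u)\<^sup>2) - 1 \<ge> 0" by simp
    moreover have "((\<lambda>\<phi>. elliptic_F \<phi> k - \<phi>) has_real_derivative
        1 / sqrt (1 - k\<^sup>2 * (sin u)\<^sup>2) - 1) (at u)"
      by (intro derivative_intros elliptic_F_has_real_derivative assms)
    ultimately show "\<exists>y. ((\<lambda>\<phi>. elliptic_F \<phi> k - \<phi>) has_real_derivative y) (at u) \<and> 0 \<le> y"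
      by blast
  qed
  then show ?thesis by simp
qed

lemma elliptic_F_surj:
  assumes "0 \<le> k" "k < 1"
  shows "\<exists>\<phi>. elliptic_F \<phi> k = x"
proof -
  have "isCont (\<lambda>\<phi>. elliptic_F \<phi> k) u" for u
    using DERIV_isCont[OF elliptic_F_has_real_derivative[OF assms]] .
  moreover have "elliptic_F (- \<bar>x\<bar>) k \<le> x" "x \<le> elliptic_F \<bar>x\<bar> k"
    using elliptic_F_expands[OF assms, of 0 "\<bar>x\<bar>"] elliptic_F_expands[OF assms, of "-\<bar>x\<bar>" 0]
    by auto
  ultimately show ?thesis
    using IVT[of "\<lambda>\<phi>. elliptic_F \<phi> k" "-\<bar>x\<bar>" x "\<bar>x\<bar>"] by auto
qed

lemma jacobi_am_elliptic_F [simp]: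
  assumes "0 \<le> k" "k < 1"
  shows "jacobi_am (elliptic_F \<phi> k) k = \<phi>"
  unfolding jacobi_am_def
  using strict_mono_eq[OF elliptic_F_strict_mono[OF assms]] by auto

lemma elliptic_F_jacobi_am [simp]:
  assumes "0 \<le> k" "k < 1"
  shows "elliptic_F (jacobi_am x k) k = x"
  using elliptic_F_surj[OF assms] jacobi_am_elliptic_F[OF assms] by metis

lemma elliptic_F_add_period:
  assumes "0 \<le> k" "k < 1"
  shows "elliptic_F (\<phi> + 2 * pi) k = elliptic_F \<phi> k + elliptic_F (2 * pi) k"
proof -
  let ?h = "\<lambda>\<phi>. elliptic_F (\<phi> + 2 * pi) k - elliptic_F \<phi> k"
  have "(?h has_real_derivative 0) (at u)" for u
  proof -
    have "((\<lambda>\<phi>. elliptic_F (\<phi> + 2 * pi) k) has_real_derivative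
        1 / sqrt (1 - k\<^sup>2 * (sin (u + 2 * pi))\<^sup>2)) (at u)"
      using elliptic_F_has_real_derivative[OF assms, of "u + 2 * pi"]
      by (simp add: DERIV_shift add.commute)
    from DERIV_diff[OF this elliptic_F_has_real_derivative[OF assms, of u]]
    show ?thesis by simp
  qed
  then have "?h \<phi> = ?h 0" using DERIV_isconst_all by blast
  then show ?thesis by simp
qed

lemma jacobi_am_add_period:
  assumes "0 \<le> k" "k < 1"
  shows "jacobi_am (x + elliptic_F (2 * pi) k) k = jacobi_am x k + 2 * pi"
  by (metis assms elliptic_F_add_period elliptic_F_jacobi_am jacobi_am_elliptic_F)

definition jacobi_dn :: "real \<Rightarrow> real \<Rightarrow> real" where
  "jacobi_dn x k = sqrt (1 - k\<^sup>2 * (jacobi_sn x k)\<^sup>2)"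

lemma jacobi_am_has_real_derivative:
  assumes "0 \<le> k" "k < 1"
  shows "((\<lambda>x. jacobi_am x k) has_real_derivative jacobi_dn x k) (at x)"
proof -
  have 1: "isCont (\<lambda>x. jacobi_am x k) (elliptic_F (jacobi_am x k) k)"
    by (rule isCont_inverse_function[where d = 1])
      (use assms DERIV_isCont[OF elliptic_F_has_real_derivative[OF assms]] in auto)
  have "((\<lambda>x. jacobi_am x k) has_real_derivative
      inverse (1 / sqrt (1 - k\<^sup>2 * (sin (jacobi_am x k))\<^sup>2))) (at x)"
    by (rule DERIV_inverse_function[where a = "x - 1" and b = "x + 1" and f = "\<lambda>\<phi>. elliptic_F \<phi> k"])
      (use assms 1 elliptic_F_has_real_derivative[OF assms]
        elliptic_modulus_pos[OF assms, of "jacobi_am x k"] in auto)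
  then show ?thesis by (simp add: jacobi_dn_def jacobi_sn_def)
qed

lemma jacobi_dn_pos:
  assumes "0 \<le> k" "k < 1"
  shows "jacobi_dn x k > 0"
  using elliptic_modulus_pos[OF assms] by (simp add: jacobi_dn_def jacobi_sn_def)

lemma jacobi_sn_cn: "(jacobi_sn x k)\<^sup>2 + (jacobi_cn x k)\<^sup>2 = 1"
  by (simp add: jacobi_sn_def jacobi_cn_def)

lemma jacobi_dn_squared:
  assumes "0 \<le> k" "k < 1"
  shows "(jacobi_dn x k)\<^sup>2 = 1 - k\<^sup>2 * (jacobi_sn x k)\<^sup>2"
  using elliptic_modulus_pos[OF assms, of "jacobi_am x k"] by (simp add: jacobi_dn_def jacobi_sn_def)

lemma jacobi_sn_has_real_derivative:
  assumes "0 \<le> k" "k < 1"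
  shows "((\<lambda>x. jacobi_sn x k) has_real_derivative jacobi_cn x k * jacobi_dn x k) (at x)"
  unfolding jacobi_sn_def jacobi_cn_def
  by (rule DERIV_fun_sin jacobi_am_has_real_derivative assms)+

lemma jacobi_cn_has_real_derivative:
  assumes "0 \<le> k" "k < 1"
  shows "((\<lambda>x. jacobi_cn x k) has_real_derivative - (jacobi_sn x k * jacobi_dn x k)) (at x)"
  unfolding jacobi_sn_def jacobi_cn_def
  using DERIV_fun_cos[OF jacobi_am_has_real_derivative[OF assms, of x]] by simp

lemma jacobi_dn_has_real_derivative:
  assumes "0 \<le> k" "k < 1"
  shows "((\<lambda>x. jacobi_dn x k) has_real_derivative - (k\<^sup>2 * jacobi_sn x k * jacobi_cn x k)) (at x)"
proof -
  have "((\<lambda>x. 1 - k\<^sup>2 * (jacobi_sn x k)\<^sup>2) has_real_derivative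
      - (2 * k\<^sup>2 * jacobi_sn x k * (jacobi_cn x k * jacobi_dn x k))) (at x)"
    by (rule derivative_eq_intros jacobi_sn_has_real_derivative assms | simp)+
  from DERIV_real_sqrt[THEN DERIV_chain2, OF _ this] elliptic_modulus_pos[OF assms, of "jacobi_am x k"]
  have "((\<lambda>x. sqrt (1 - k\<^sup>2 * (jacobi_sn x k)\<^sup>2)) has_real_derivative
      inverse (jacobi_dn x k) / 2 * - (2 * k\<^sup>2 * jacobi_sn x k * (jacobi_cn x k * jacobi_dn x k))) (at x)"
    by (simp add: jacobi_dn_def jacobi_sn_def)
  with jacobi_dn_pos[OF assms, of x] show ?thesis
    by (simp add: jacobi_dn_def[abs_def] field_simps)
qed

lemma jacobi_add_period:
  assumes "0 \<le> k" "k < 1"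
  shows "jacobi_sn (x + elliptic_F (2 * pi) k) k = jacobi_sn x k"
    and "jacobi_cn (x + elliptic_F (2 * pi) k) k = jacobi_cn x k"
    and "jacobi_dn (x + elliptic_F (2 * pi) k) k = jacobi_dn x k"
  by (simp_all add: jacobi_sn_def jacobi_cn_def jacobi_dn_def jacobi_am_add_period assms)

lemma elliptic_F_period_pos:
  assumes "0 \<le> k" "k < 1"
  shows "elliptic_F (2 * pi) k > 0"
  using elliptic_F_expands[OF assms, of 0 "2 * pi"] pi_gt_zero by (simp, linarith)

section \<open>The profile of the stationary solution\<close>

locale elliptic_parameters =
  fixes k b :: real
  assumes k_nonneg: "0 \<le> k" and k_less: "k < 1" and k_le_b: "k\<^sup>2 \<le> b" and b_le: "b \<le> 1"
    and b_pos: "0 < b"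
begin

abbreviation "R \<equiv> ell_R k b"
abbreviation "\<omega> \<equiv> ell_omega k b"
abbreviation "c \<equiv> ell_c k b"
abbreviation "sn x \<equiv> jacobi_sn x k"
abbreviation "cn x \<equiv> jacobi_cn x k"
abbreviation "dn x \<equiv> jacobi_dn x k"

text \<open>
  \<open>T\<close> is the full period \<open>4 K(k)\<close>: for \<open>b = k\<^sup>2\<close> the shift by \<open>2 K(k)\<close> changes the sign of \<open>R\<close>.
\<close>

definition T :: real where "T = elliptic_F (2 * pi) k"

definition w :: "real \<Rightarrow> real" where "w x = b - k\<^sup>2 * (sn x)\<^sup>2"

definition w' :: "real \<Rightarrow> real" where "w' x = - (2 * k\<^sup>2 * sn x * cn x * dn x)"

text \<open>For \<open>b = k\<^sup>2\<close> the quotient would break down at the zeros of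
  \<open>cn\<close>.\<close>

definition R' :: "real \<Rightarrow> real" where
  "R' x = (if b = k\<^sup>2 then - (k * sn x * dn x) else w' x / (2 * R x))"

text \<open>
  \<open>C1\<close> and \<open>- c\<^sup>2\<close> are the lower coefficients of the cubic \<open>(b - w) (w - b + k\<^sup>2) (w + 1 - b) = w'\<^sup>2 / 4\<close>.
\<close>

definition C1 :: real where "C1 = (2 * b - k\<^sup>2) * (1 - b) - b * (b - k\<^sup>2)"

lemmas jacobi_derivs =
  jacobi_sn_has_real_derivative[OF k_nonneg k_less] jacobi_cn_has_real_derivative[OF k_nonneg k_less]
  jacobi_dn_has_real_derivative[OF k_nonneg k_less]

lemma cn_squared: "(cn x)\<^sup>2 = 1 - (sn x)\<^sup>2"
  using jacobi_sn_cn[of x k] by simp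

lemma dn_squared: "(dn x)\<^sup>2 = 1 - k\<^sup>2 * (sn x)\<^sup>2"
  by (rule jacobi_dn_squared[OF k_nonneg k_less])

lemma sn_bound: "0 \<le> k\<^sup>2 * (sn x)\<^sup>2" "k\<^sup>2 * (sn x)\<^sup>2 \<le> k\<^sup>2"
  by (auto simp: jacobi_sn_def abs_square_le_1 mult_left_le)

lemma w_bounds: "b - k\<^sup>2 \<le> w x" "w x \<le> b"
  using sn_bound[of x] by (auto simp: w_def)

lemma w_nonneg: "0 \<le> w x"
  using w_bounds[of x] k_le_b by linarith

lemma R_squared: "(R x)\<^sup>2 = w x"
  using w_nonneg[of x] unfolding ell_R_def w_def
  by (auto simp: power_mult_distrib cn_squared right_diff_distrib)

lemma R_pos: "b \<noteq> k\<^sup>2 \<Longrightarrow> 0 < R x"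
  using w_bounds[of x] k_le_b by (auto simp: ell_R_def w_def)

lemma c_squared: "c\<^sup>2 = b * (1 - b) * (b - k\<^sup>2)"
  using b_pos b_le k_le_b by (simp add: ell_c_def)

lemma c_eq_0_or_R_nonzero: "c = 0 \<or> R x \<noteq> 0"
  using R_pos[of x] by (auto simp: ell_c_def)

lemma w_deriv: "(w has_real_derivative w' x) (at x)"
  unfolding w_def[abs_def] w'_def by (rule derivative_eq_intros jacobi_derivs | simp)+

text \<open>The three factors of the cubic are \<open>k\<^sup>2 * sn\<^sup>2\<close>,
  \<open>k\<^sup>2 * cn\<^sup>2\<close> and \<open>dn\<^sup>2\<close>.\<close>

lemma w'_squared: "(w' x)\<^sup>2 = 4 * (- ((w x)^3) - 2 * \<omega> * (w x)\<^sup>2 + C1 * w x - c\<^sup>2)"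
proof -
  have "(w' x)\<^sup>2 = 4 * k^4 * (sn x)\<^sup>2 * (cn x)\<^sup>2 * (dn x)\<^sup>2"
    unfolding w'_def by algebra
  also have "\<dots> = 4 * (- ((w x)^3) - 2 * \<omega> * (w x)\<^sup>2 + C1 * w x - c\<^sup>2)"
    unfolding cn_squared dn_squared c_squared C1_def ell_omega_def w_def
    by (simp add: field_simps) algebra
  finally show ?thesis .
qed

text \<open>Formally this is \<open>w'_squared\<close> differentiated and divided by
  \<open>2 * w'\<close>; as \<open>w'\<close> has zeros, the Jacobi derivatives are used
  instead.\<close>

lemma w'_deriv: "(w' has_real_derivative - 6 * (w x)\<^sup>2 - 8 * \<omega> * w x + 2 * C1) (at x)"
proof -
  have "(w' has_real_derivative - (2 * k\<^sup>2 * ((cn x)\<^sup>2 * (dn x)\<^sup>2 - (sn x)\<^sup>2 * (dn x)\<^sup>2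
      - k\<^sup>2 * (sn x)\<^sup>2 * (cn x)\<^sup>2))) (at x)"
    unfolding w'_def[abs_def]
    by (rule derivative_eq_intros jacobi_derivs refl)+ (simp, algebra)
  also have "- (2 * k\<^sup>2 * ((cn x)\<^sup>2 * (dn x)\<^sup>2 - (sn x)\<^sup>2 * (dn x)\<^sup>2 - k\<^sup>2 * (sn x)\<^sup>2 * (cn x)\<^sup>2))
      = - 6 * (w x)\<^sup>2 - 8 * \<omega> * w x + 2 * C1"
    unfolding cn_squared dn_squared C1_def ell_omega_def w_def
    by (simp add: field_simps) algebra
  finally show ?thesis .
qed

lemma R_R': "2 * R x * R' x = w' x"
  using R_pos[of x] by (auto simp: R'_def ell_R_def w'_def power2_eq_square)

lemma R_deriv: "(R has_real_derivative R' x) (at x)"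
proof (cases "b = k\<^sup>2")
  case True
  then show ?thesis
    unfolding ell_R_def[abs_def] R'_def
    by simp (rule derivative_eq_intros jacobi_derivs refl | simp)+
next
  case False
  have pos: "0 < w x" using R_pos[OF False, of x] R_squared[of x] by (metis zero_less_power)
  have "((\<lambda>x. sqrt (w x)) has_real_derivative (inverse (sqrt (w x)) / 2) * w' x) (at x)"
    by (rule DERIV_chain2[OF DERIV_real_sqrt[OF pos] w_deriv])
  moreover have R: "R = (\<lambda>x. sqrt (w x))" using False by (simp add: ell_R_def[abs_def] w_def)
  ultimately show ?thesis using False by (simp add: R'_def R field_simps)
qed

lemma R'_squared: "(R' x)\<^sup>2 = - ((R x)^4) - 2 * \<omega> * (R x)\<^sup>2 + C1 - c\<^sup>2 / (R x)\<^sup>2"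
proof (cases "b = k\<^sup>2")
  case True
  then have c: "c = 0" by (simp add: ell_c_def)
  have "(R' x)\<^sup>2 = b * (sn x)\<^sup>2 * (dn x)\<^sup>2"
    unfolding R'_def if_P[OF True] by (simp add: power_mult_distrib True)
  moreover have "(R x)^4 = (w x)\<^sup>2" by (simp flip: R_squared)
  ultimately show ?thesis
    unfolding R_squared c dn_squared w_def C1_def ell_omega_def
    using True by (simp add: field_simps) algebra
next
  case False
  have "4 * (R x)\<^sup>2 * (R' x)\<^sup>2 = (w' x)\<^sup>2" unfolding R_R'[symmetric] by algebra
  also have "\<dots> = 4 * (R x)\<^sup>2 * (- ((R x)^4) - 2 * \<omega> * (R x)\<^sup>2 + C1 - c\<^sup>2 / (R x)\<^sup>2)"
    unfolding w'_squared R_squared[symmetric] using R_pos[OF False, of x]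
    by (simp add: field_simps)
  finally show ?thesis using R_pos[OF False, of x] by simp
qed

text \<open>Modulus part of the stationary NLS equation in polar form, with
  \<open>\<theta>' = c / R\<^sup>2\<close>; \<open>R'_squared\<close> is its first integral.\<close>

lemma R'_deriv: "(R' has_real_derivative - 2 * (R x)^3 - 2 * \<omega> * R x + c\<^sup>2 / (R x)^3) (at x)"
proof (cases "b = k\<^sup>2")
  case True
  then have c: "c = 0" by (simp add: ell_c_def)
  have "(R' has_real_derivative - (k * cn x * ((dn x)\<^sup>2 - k\<^sup>2 * (sn x)\<^sup>2))) (at x)"
    unfolding R'_def[abs_def] using True
    by simp (rule derivative_eq_intros jacobi_derivs refl | simp add: algebra_simps power2_eq_square)+
  also have "- (k * cn x * ((dn x)\<^sup>2 - k\<^sup>2 * (sn x)\<^sup>2)) = - 2 * (k * cn x) * (w x + \<omega>)"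
    unfolding dn_squared w_def ell_omega_def by (simp add: True field_simps)
  also have "\<dots> = - 2 * (R x)^3 - 2 * \<omega> * R x + c\<^sup>2 / (R x)^3"
    unfolding R_squared[symmetric] c using True
    by (simp add: ell_R_def algebra_simps power2_eq_square power3_eq_cube)
  finally show ?thesis .
next
  case False
  have eq: "R' = (\<lambda>x. w' x / (2 * R x))" using False by (simp add: R'_def[abs_def])
  have "((\<lambda>x. w' x / (2 * R x)) has_real_derivative
      ((- 6 * (w x)\<^sup>2 - 8 * \<omega> * w x + 2 * C1) * (2 * R x) - w' x * (2 * R' x)) / (2 * R x * (2 * R x))) (at x)"
    using R_pos[OF False, of x]
    by (intro DERIV_divide w'_deriv DERIV_cmult R_deriv) auto
  also have "((- 6 * (w x)\<^sup>2 - 8 * \<omega> * w x + 2 * C1) * (2 * R x) - w' x * (2 * R' x)) / (2 * R x * (2 * R x))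
      = (- 3 * (w x)\<^sup>2 - 4 * \<omega> * w x + C1 - (R' x)\<^sup>2) / R x"
    unfolding R_R'[symmetric] using R_pos[OF False, of x] by (simp add: field_simps power2_eq_square)
  also have "\<dots> = - 2 * (R x)^3 - 2 * \<omega> * R x + c\<^sup>2 / (R x)^3"
    unfolding R'_squared R_squared[symmetric] using R_pos[OF False, of x]
    by (simp add: field_simps power2_eq_square power3_eq_cube power4_eq_xxxx)
  finally show ?thesis unfolding eq .
qed

lemma T_pos: "0 < T"
  unfolding T_def by (rule elliptic_F_period_pos[OF k_nonneg k_less])

lemma periodic: "w (x + T) = w x" "w' (x + T) = w' x" "R (x + T) = R x" "R' (x + T) = R' x"
  by (simp_all add: T_def w_def w'_def R'_def ell_R_def jacobi_add_period[OF k_nonneg k_less])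

lemma continuous_profile: "continuous_on X w" "continuous_on X w'" "continuous_on X R" "continuous_on X R'"
  by (meson DERIV_isCont continuous_at_imp_continuous_on w_deriv w'_deriv R_deriv R'_deriv)+

end

section \<open>The period integral near a branch point\<close>

lemma has_vector_derivative_inverse:
  fixes f :: "real \<Rightarrow> complex"
  assumes "(f has_vector_derivative f') (at x)" "f x \<noteq> 0"
  shows "((\<lambda>x. inverse (f x)) has_vector_derivative - f' / (f x)\<^sup>2) (at x)"
proof -
  have "((inverse \<circ> f) has_vector_derivative f' * - (inverse (f x) * inverse (f x))) (at x)"
    by (rule field_vector_diff_chain_at[OF assms(1)])
      (use DERIV_inverse[OF assms(2)] in \<open>simp add: power2_eq_square\<close>)
  then show ?thesis by (simp add: o_def field_simps power2_eq_square)
qed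

text \<open>Puts the derivative of \<open>G\<close> in \<open>J_zeta0\<close> over one denominator;
  the \<open>a - 0\<close> matches the output of the derivative rules.\<close>

lemma quotient_identity:
  fixes W :: complex
  assumes "W \<noteq> 0"
  shows "(a / 2 * (- (a - 0) / W\<^sup>2) + v / 2 * inverse W) - \<i> * Q * (- (a - 0) / W\<^sup>2)
    = ((v * W - a\<^sup>2) / 2 + \<i> * Q * a) / W\<^sup>2"
  using assms by (simp add: field_simps power2_eq_square)

text \<open>Polynomial core of \<open>J_zeta0\<close>, with \<open>\<zeta>0\<close>,
  \<open>e0\<close>, \<open>\<omega>\<close>, \<open>c\<close> for \<open>z\<close>,
  \<open>e\<close>, \<open>u\<close>, \<open>d\<close>: the relations for a root of \<open>P\<close>
  make the numerator collapse.\<close>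

lemma reduction_identity:
  fixes z :: complex
  assumes "2 * z\<^sup>2 = u + e" "C = - e\<^sup>2 + 4 * d * z" "X = W + e"
  shows "((- 6 * X\<^sup>2 - 8 * u * X + 2 * C) * W - 4 * (- (X^3) - 2 * u * X\<^sup>2 + C * X - d\<^sup>2)) / 2
    = - 4 * (d - 2 * z * e) * (z * X - d / 2) - W ^ 3"
proof -
  have u: "u = 2 * z\<^sup>2 - e" using assms(1) by algebra
  show ?thesis unfolding assms(2,3) u
    by (simp add: field_simps power2_eq_square power3_eq_cube)
qed

context elliptic_parameters
begin

text \<open>The cubic for \<open>w\<close> has the roots \<open>q\<^sup>2\<close>,
  \<open>r\<^sup>2\<close>, \<open>- p\<^sup>2\<close>, and the roots of \<open>P\<close> are the
  halves of \<open>- p \<plusminus> \<i> (q + r)\<close> and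
  \<open>p \<plusminus> \<i> (q - r)\<close>.\<close>

definition p :: real where "p = sqrt (1 - b)"
definition q :: real where "q = sqrt b"
definition r :: real where "r = sqrt (b - k\<^sup>2)"

text \<open>
  \<open>P\<close> is the polynomial with \<open>\<Omega>\<^sup>2 = P \<zeta>\<close> (spectral curve of the Lax pair), \<open>h = R / B\<close> where \<open>B\<close> is the
  off-diagonal entry of the stationary Lax matrix. Written over the denominator \<open>Den\<close>, \<open>h\<close> is
  defined also at the zeros of \<open>R\<close> and depends only on \<open>w = R\<^sup>2\<close>.
\<close>

definition P :: "complex \<Rightarrow> complex" where
  "P \<zeta> = - (\<zeta> ^ 4) + of_real \<omega> * \<zeta>\<^sup>2 + of_real c * \<zeta> - of_real (\<omega>\<^sup>2 / 4 + C1 / 4)"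

definition Den :: "complex \<Rightarrow> real \<Rightarrow> complex" where
  "Den \<zeta> x = ((of_real (w x))\<^sup>2 + 2 * (of_real \<omega> - 2 * \<zeta>\<^sup>2) * of_real (w x)
     + 4 * of_real c * \<zeta> - of_real C1) / 4"

definition h :: "complex \<Rightarrow> real \<Rightarrow> complex" where
  "h \<zeta> x = - (\<zeta> * of_real (w x) - of_real c / 2 - \<i> * of_real (w' x) / 4) / Den \<zeta> x"

definition J :: "complex \<Rightarrow> complex" where "J \<zeta> = integral {0..T} (h \<zeta>)"

text \<open>
  \<open>\<zeta>0\<close> is one of the four roots of \<open>P\<close>. The choice matters: \<open>Re e0 = - q r \<le> 0 \<le> w\<close>, so that
  \<open>Den \<zeta>0 = (w - e0)\<^sup>2 / 4\<close> has no zero; for \<open>b = 1\<close> there are roots of \<open>P\<close> where it has.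
\<close>

definition \<zeta>0 :: complex where "\<zeta>0 = (- of_real p + \<i> * of_real (q + r)) / 2"

definition e0 :: complex where "e0 = - of_real (q * r) - \<i> * of_real (p * (q + r))"

section \<open>Algebra at the branch point \<open>\<zeta>0\<close>\<close>

lemma pqr: "p \<ge> 0" "q > 0" "r \<ge> 0" "p\<^sup>2 = 1 - b" "q\<^sup>2 = b" "r\<^sup>2 = b - k\<^sup>2" "c = p * q * r"
  using b_pos b_le k_le_b by (simp_all add: p_def q_def r_def ell_c_def real_sqrt_mult)

lemma omega_pqr: "2 * \<omega> = p\<^sup>2 - q\<^sup>2 - r\<^sup>2"
  by (simp add: pqr ell_omega_def field_simps)

lemma C1_pqr: "C1 = (q\<^sup>2 + r\<^sup>2) * p\<^sup>2 - q\<^sup>2 * r\<^sup>2"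
  by (simp add: pqr C1_def)

lemma zeta0_squared: "2 * \<zeta>0\<^sup>2 = of_real \<omega> + e0"
proof -
  have "4 * \<zeta>0\<^sup>2 = of_real (2 * \<omega>) + 2 * e0"
    unfolding omega_pqr \<zeta>0_def e0_def
    by (simp add: complex_eq_iff power2_eq_square field_simps)
  then show ?thesis unfolding of_real_mult of_real_numeral by algebra
qed

text \<open>With \<open>zeta0_squared\<close> this turns \<open>4 * Den \<zeta>0\<close> into the
  square of \<open>w - e0\<close>.\<close>

lemma C1_zeta0: "of_real C1 = - e0\<^sup>2 + 4 * of_real c * \<zeta>0"
  unfolding C1_pqr \<zeta>0_def e0_def pqr(7)
  by (simp add: complex_eq_iff power2_eq_square algebra_simps)

lemma P_zeta0: "P \<zeta>0 = 0"
proof -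
  have "4 * P \<zeta>0 = - ((2 * \<zeta>0\<^sup>2)\<^sup>2) + 2 * of_real \<omega> * (2 * \<zeta>0\<^sup>2) + 4 * of_real c * \<zeta>0
      - (of_real \<omega>)\<^sup>2 - of_real C1"
    by (simp add: P_def field_simps power_mult_distrib)
  also have "\<dots> = 0" unfolding zeta0_squared C1_zeta0 by algebra
  finally show ?thesis by simp
qed

text \<open>Completing the square in \<open>w\<close> leaves exactly \<open>P \<zeta>\<close> as
  remainder.\<close>

lemma Den_P: "Den \<zeta> x = (of_real (w x) - 2 * \<zeta>\<^sup>2 + of_real \<omega>)\<^sup>2 / 4 + P \<zeta>"
  unfolding Den_def P_def by (simp add: field_simps) algebra

lemma Den_zeta0: "Den \<zeta>0 x = (of_real (w x) - e0)\<^sup>2 / 4"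
  unfolding Den_P P_zeta0 zeta0_squared by simp

text \<open>Otherwise \<open>b = k\<^sup>2\<close> and \<open>b = 1\<close>, contrary to
  \<open>k < 1\<close>.\<close>

lemma r_or_p_pos: "r > 0 \<or> p > 0"
  using k_nonneg k_less b_le power_less_one_iff[of k 2] by (auto simp: r_def p_def)

text \<open>Since \<open>Re e0 \<le> 0 \<le> w\<close>, the point \<open>w\<close> is at least as
  far from \<open>e0\<close> as the origin is; the left side is the squared norm of
  \<open>e0\<close>.\<close>

lemma norm_w_e0: "(q * r)\<^sup>2 + (p * (q + r))\<^sup>2 \<le> (norm (of_real (w x) - e0))\<^sup>2"
  "0 < (q * r)\<^sup>2 + (p * (q + r))\<^sup>2"
proof -
  have "(q * r)\<^sup>2 \<le> (w x + q * r)\<^sup>2"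
    using w_nonneg[of x] pqr by (intro power_mono) auto
  then show "(q * r)\<^sup>2 + (p * (q + r))\<^sup>2 \<le> (norm (of_real (w x) - e0))\<^sup>2"
    by (simp add: cmod_power2 e0_def)
  show "0 < (q * r)\<^sup>2 + (p * (q + r))\<^sup>2"
    using r_or_p_pos pqr by (auto simp: add_pos_nonneg add_nonneg_pos)
qed

lemma w_e0_nonzero: "of_real (w x) - e0 \<noteq> 0"
  using norm_w_e0(1)[of x] norm_w_e0(2) by auto

text \<open>The bound \<open>\<delta>\<close> below \<open>norm (Den \<zeta>0 x)\<close> is uniform
  in \<open>x\<close>, and \<open>0 \<le> w \<le> 1\<close> makes the variation of
  \<open>Den\<close> in \<open>\<zeta>\<close> uniform too.\<close>

lemma Den_nonzero_nbhd:
  obtains N where "open N" "\<zeta>0 \<in> N" "\<And>\<zeta> x. \<zeta> \<in> N \<Longrightarrow> Den \<zeta> x \<noteq> 0"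
proof
  define \<delta> where "\<delta> = ((q * r)\<^sup>2 + (p * (q + r))\<^sup>2) / 4"
  let ?N = "{\<zeta>. norm (\<zeta>\<^sup>2 - \<zeta>0\<^sup>2) + norm (of_real c * (\<zeta> - \<zeta>0)) < \<delta>}"
  show "open ?N" by (intro open_Collect_less continuous_intros)
  show "\<zeta>0 \<in> ?N" using norm_w_e0(2) by (simp add: \<delta>_def)
  show "Den \<zeta> x \<noteq> 0" if "\<zeta> \<in> ?N" for \<zeta> x
  proof
    assume "Den \<zeta> x = 0"
    then have "Den \<zeta>0 x = Den \<zeta>0 x - Den \<zeta> x" by simp
    also have "\<dots> = of_real (w x) * (\<zeta>\<^sup>2 - \<zeta>0\<^sup>2) - of_real c * (\<zeta> - \<zeta>0)"
      by (simp add: Den_def field_simps)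
    also have "norm \<dots> \<le> 1 * norm (\<zeta>\<^sup>2 - \<zeta>0\<^sup>2) + norm (of_real c * (\<zeta> - \<zeta>0))"
      using w_nonneg[of x] w_bounds[of x] b_le
      by (intro order_trans[OF norm_triangle_ineq4] add_mono)
        (auto simp: norm_mult intro!: mult_left_le_one_le)
    also have "\<dots> < \<delta>" using that by simp
    finally have "norm (Den \<zeta>0 x) < \<delta>" .
    then show False using norm_w_e0(1)[of x] by (simp add: Den_zeta0 \<delta>_def norm_divide norm_power)
  qed
qed

lemma continuous_h:
  assumes "\<And>x. Den \<zeta> x \<noteq> 0"
  shows "continuous_on X (h \<zeta>)"
proof -
  have "continuous_on X (Den \<zeta>)"
    unfolding Den_def[abs_def] by (intro continuous_intros continuous_profile) simp
  then show ?thesis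
    unfolding h_def[abs_def] using assms
    by (intro continuous_intros continuous_profile) auto
qed

section \<open>The period integral: holomorphy and its value at \<open>\<zeta>0\<close>\<close>

lemma J_holomorphic:
  assumes N: "\<And>\<zeta> x. \<zeta> \<in> N \<Longrightarrow> Den \<zeta> x \<noteq> 0" and "convex N"
  shows "J holomorphic_on N"
proof -
  let ?n = "\<lambda>\<zeta> x. - (\<zeta> * of_real (w x) - of_real c / 2 - \<i> * of_real (w' x) / 4)"
  let ?h' = "\<lambda>\<zeta> x. (- of_real (w x) * Den \<zeta> x - ?n \<zeta> x * (of_real c - 2 * \<zeta> * of_real (w x)))
    / (Den \<zeta> x * Den \<zeta> x)"
  have cont: "continuous_on Y (\<lambda>z. w (snd z))" "continuous_on Y (\<lambda>z. w' (snd z))"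
    for Y :: "(complex \<times> real) set"
    by (rule continuous_on_compose2[OF continuous_profile(1)[of UNIV]]
        continuous_on_compose2[OF continuous_profile(2)[of UNIV]] continuous_intros subset_UNIV)+
  have "(\<lambda>\<zeta>. integral (cbox 0 T) (h \<zeta>)) holomorphic_on N"
  proof (rule leibniz_rule_holomorphic[where fx = ?h'])
    fix \<zeta> t assume "\<zeta> \<in> N"
    have "((\<lambda>\<zeta>. Den \<zeta> t) has_field_derivative of_real c - 2 * \<zeta> * of_real (w t)) (at \<zeta> within N)"
      unfolding Den_def by (rule derivative_eq_intros refl | simp)+
    moreover have "((\<lambda>\<zeta>. ?n \<zeta> t) has_field_derivative - of_real (w t)) (at \<zeta> within N)"
      by (rule derivative_eq_intros refl | simp)+
    ultimately show "((\<lambda>\<zeta>. h \<zeta> t) has_field_derivative ?h' \<zeta> t) (at \<zeta> within N)"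
      unfolding h_def using N[OF \<open>\<zeta> \<in> N\<close>] by (intro DERIV_divide)
  next
    fix \<zeta> assume "\<zeta> \<in> N"
    then show "h \<zeta> integrable_on cbox 0 T"
      using continuous_h[OF N] by (intro integrable_continuous) blast
  next
    show "continuous_on (N \<times> cbox 0 T) (\<lambda>(\<zeta>, t). ?h' \<zeta> t)"
      unfolding case_prod_beta
    proof (rule continuous_on_divide)
      have Den: "continuous_on (N \<times> cbox 0 T) (\<lambda>z. Den (fst z) (snd z))"
        unfolding Den_def by (intro continuous_intros cont) auto
      show "continuous_on (N \<times> cbox 0 T) (\<lambda>z. Den (fst z) (snd z) * Den (fst z) (snd z))"
        by (intro continuous_on_mult Den)
      show "continuous_on (N \<times> cbox 0 T) (\<lambda>z. - of_real (w (snd z)) * Den (fst z) (snd z)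
          - ?n (fst z) (snd z) * (of_real c - 2 * fst z * of_real (w (snd z))))"
        by (intro continuous_intros cont Den) auto
      show "\<forall>z\<in>N \<times> cbox 0 T. Den (fst z) (snd z) * Den (fst z) (snd z) \<noteq> 0"
        using N by auto
    qed
  qed (rule \<open>convex N\<close>)
  then show ?thesis by (simp add: J_def[abs_def])
qed

definition S :: real where "S = integral {0..T} w"

text \<open>
  The factor on the left is \<open>P' \<zeta>0\<close>. The third-kind integral \<open>J \<zeta>0\<close> degenerates:
  \<open>P' \<zeta>0 * h = (w - e0) + G'\<close> with a periodic function \<open>G\<close>.
\<close>

lemma J_zeta0: "(of_real c - 2 * \<zeta>0 * e0) * J \<zeta>0 = of_real S - e0 * of_real T"
proof -
  define P' where "P' = of_real c - 2 * \<zeta>0 * e0"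
  \<comment> \<open>The second summand is a primitive of the part of \<open>P' * h\<close> with
    \<open>w'\<close> in the numerator; the first reduces the remaining part to
    \<open>w - e0\<close>.\<close>
  define G where "G x = of_real (w' x) / 2 * inverse (of_real (w x) - e0)
      - \<i> * P' * inverse (of_real (w x) - e0)" for x
  have der: "(G has_vector_derivative P' * h \<zeta>0 x - (of_real (w x) - e0)) (at x)" for x
  proof -
    let ?W = "of_real (w x) - e0"
    let ?w2 = "- 6 * (w x)\<^sup>2 - 8 * \<omega> * w x + 2 * C1"
    have inv: "((\<lambda>x. inverse (of_real (w x) - e0)) has_vector_derivative
        - (of_real (w' x) - 0) / ?W\<^sup>2) (at x)"
      by (intro has_vector_derivative_inverse derivative_intros w_deriv w_e0_nonzero)
    have "(G has_vector_derivative
        (of_real (w' x) / 2 * (- (of_real (w' x) - 0) / ?W\<^sup>2) + of_real ?w2 / 2 * inverse ?W)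
        - \<i> * P' * (- (of_real (w' x) - 0) / ?W\<^sup>2)) (at x)"
      unfolding G_def by (intro derivative_intros inv w'_deriv)
    also have "(of_real (w' x) / 2 * (- (of_real (w' x) - 0) / ?W\<^sup>2) + of_real ?w2 / 2 * inverse ?W)
        - \<i> * P' * (- (of_real (w' x) - 0) / ?W\<^sup>2)
      = ((of_real ?w2 * ?W - of_real ((w' x)\<^sup>2)) / 2 + \<i> * P' * of_real (w' x)) / ?W\<^sup>2"
      using quotient_identity[OF w_e0_nonzero[of x]] by simp
    also have "\<dots> = P' * h \<zeta>0 x - ?W"
    proof -
      define W where "W = ?W"
      have W: "W \<noteq> 0" "of_real (w x) = W + e0" using w_e0_nonzero[of x] by (auto simp: W_def)
      have numerator: "(of_real ?w2 * W - of_real ((w' x)\<^sup>2)) / 2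
          = - 4 * P' * (\<zeta>0 * of_real (w x) - of_real c / 2) - W ^ 3"
        using reduction_identity[OF zeta0_squared C1_zeta0 W(2)] unfolding w'_squared P'_def
        by simp
      have "(- 4 * P' * X - W ^ 3 + \<i> * P' * a) / W\<^sup>2
          = P' * (- (X - \<i> * a / 4) / (W\<^sup>2 / 4)) - W" for X a
        using W(1) by (simp add: field_simps power2_eq_square power3_eq_cube)
      then show ?thesis
        unfolding h_def Den_zeta0 W_def[symmetric] numerator .
    qed
    finally show ?thesis .
  qed
  have "((\<lambda>x. P' * h \<zeta>0 x - (of_real (w x) - e0)) has_integral (G T - G 0)) {0..T}"
    by (rule fundamental_theorem_of_calculus)
      (use T_pos in simp, rule has_vector_derivative_at_within[OF der])
  moreover have "G T - G 0 = 0"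
    using periodic[of 0] by (simp add: G_def)
  ultimately have 1: "((\<lambda>x. P' * h \<zeta>0 x - (of_real (w x) - e0)) has_integral 0) {0..T}" by simp
  have "(w has_integral S) {0..T}"
    unfolding S_def by (intro integrable_integral integrable_continuous_real continuous_profile)
  then have "((\<lambda>x. complex_of_real (w x)) has_integral of_real S) {0..T}"
    by (rule has_integral_of_real)
  moreover have "((\<lambda>x. e0) has_integral e0 * of_real T) {0..T}"
    using has_integral_const_real[of e0 0 T] T_pos by (simp add: scaleR_conv_of_real mult.commute)
  ultimately have "((\<lambda>x. of_real (w x) - e0) has_integral (of_real S - e0 * of_real T)) {0..T}"
    by (rule has_integral_diff)
  from has_integral_add[OF 1 this]
  have "((\<lambda>x. P' * h \<zeta>0 x) has_integral (of_real S - e0 * of_real T)) {0..T}" by simp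
  moreover have "((\<lambda>x. P' * h \<zeta>0 x) has_integral P' * J \<zeta>0) {0..T}"
    unfolding J_def
    by (intro has_integral_mult_right integrable_integral integrable_continuous_real continuous_h)
      (use w_e0_nonzero in \<open>simp add: Den_zeta0\<close>)
  ultimately show ?thesis unfolding P'_def by (rule has_integral_unique[rotated])
qed

lemma S_bounds: "0 \<le> S" "S \<le> b * T" "r = 0 \<Longrightarrow> S < b * T"
proof -
  have int: "w integrable_on {0..T}" by (intro integrable_continuous_real continuous_profile)
  show "0 \<le> S" unfolding S_def using int w_nonneg by (rule integral_nonneg)
  have "integral {0..T} w \<le> integral {0..T} (\<lambda>_. b)"
    using int w_bounds by (intro integral_le) auto
  then show le: "S \<le> b * T" using T_pos by (simp add: S_def mult.commute)
  show "S < b * T" if "r = 0"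
  proof (rule ccontr)
    assume "\<not> S < b * T"
    with le have "S = b * T" by simp
    moreover have "integral {0..T} (\<lambda>x. b - w x) = b * T - S"
      using int T_pos by (subst integral_diff) (auto simp: S_def)
    ultimately have "integral {0..T} (\<lambda>x. b - w x) = 0" by simp
    then have 0: "\<forall>x\<in>{0..T}. b - w x = 0"
      using T_pos w_bounds by (subst (asm) integral_eq_0_iff) (auto intro!: continuous_intros continuous_profile)
    \<comment> \<open>At the quarter period \<open>sn = 1\<close>, so \<open>w = b\<close> there
      forces \<open>k = 0\<close>, and \<open>r = 0\<close> then gives \<open>b = 0\<close>.\<close>
    let ?x = "elliptic_F (pi / 2) k"
    have "?x \<in> {0..T}"
      using elliptic_F_expands[OF k_nonneg k_less, of 0 "pi/2", unfolded elliptic_F_0]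
        elliptic_F_expands[OF k_nonneg k_less, of "pi/2" "2 * pi"] pi_gt_zero
      unfolding T_def atLeastAtMost_iff by (intro conjI) linarith+
    with 0 have "w ?x = b" by auto
    then have "k\<^sup>2 = 0" by (simp add: w_def jacobi_sn_def k_nonneg k_less)
    with that b_pos show False by (simp add: r_def)
  qed
qed

text \<open>If \<open>J \<zeta>0\<close> were a real \<open>j\<close>, eliminating \<open>j\<close>
  between the real and imaginary parts of \<open>J_zeta0\<close> would give a vanishing sum of
  nonnegative terms. For \<open>r = 0\<close> the term with \<open>q\<^sup>2 * T - S\<close> is
  positive, otherwise the one with \<open>(q * r)\<^sup>2\<close>.\<close>

lemma Im_J_zeta0: "Im (J \<zeta>0) \<noteq> 0"
proof
  assume "Im (J \<zeta>0) = 0"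
  then obtain j where j: "J \<zeta>0 = of_real j" by (metis complex_is_Real_iff Reals_cases)
  let ?n = "q + r"
  have n: "?n > 0" using pqr by linarith
  have P': "of_real c - 2 * \<zeta>0 * e0 = of_real (- (p * ?n\<^sup>2)) + \<i> * of_real (?n * (q * r - p\<^sup>2))"
    unfolding \<zeta>0_def e0_def pqr(7) by (simp add: complex_eq_iff power2_eq_square field_simps)
  from J_zeta0 have eq: "(of_real (- (p * ?n\<^sup>2)) + \<i> * of_real (?n * (q * r - p\<^sup>2))) * of_real j
      = of_real (S + q * r * T) + \<i> * of_real (p * ?n * T)"
    unfolding P' j unfolding e0_def by (simp add: algebra_simps)
  have re: "- (p * ?n\<^sup>2) * j = S + q * r * T" and im: "?n * (q * r - p\<^sup>2) * j = p * ?n * T"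
    using arg_cong[OF eq, of Re] arg_cong[OF eq, of Im] by simp_all
  from im n have im': "(q * r - p\<^sup>2) * j = p * T" by simp
  have "(S + q * r * T) * (q * r - p\<^sup>2) + p\<^sup>2 * ?n\<^sup>2 * T
      = - (p * ?n\<^sup>2) * ((q * r - p\<^sup>2) * j) + p\<^sup>2 * ?n\<^sup>2 * T"
    unfolding re[symmetric] by algebra
  also have "\<dots> = 0" unfolding im' by algebra
  finally have 0: "S * q * r + (q * r)\<^sup>2 * T + p\<^sup>2 * q * r * T + p\<^sup>2 * (q\<^sup>2 * T - S) + p\<^sup>2 * r\<^sup>2 * T = 0"
    by algebra
  have nonneg: "0 \<le> S * q * r" "0 \<le> (q * r)\<^sup>2 * T" "0 \<le> p\<^sup>2 * q * r * T" "0 \<le> p\<^sup>2 * r\<^sup>2 * T"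
    "0 \<le> p\<^sup>2 * (q\<^sup>2 * T - S)"
    using S_bounds pqr(1-3) T_pos by (simp_all add: pqr(5))
  show False
  proof (cases "r = 0")
    case True
    then have "0 < p\<^sup>2 * (q\<^sup>2 * T - S)" using r_or_p_pos S_bounds(3) by (simp add: pqr(5))
    with 0 nonneg show False by linarith
  next
    case False
    then have "0 < (q * r)\<^sup>2 * T" using pqr(2) T_pos by simp
    with 0 nonneg show False by linarith
  qed
qed

lemma P_deriv: "(P has_field_derivative - 4 * \<zeta>^3 + 2 * of_real \<omega> * \<zeta> + of_real c) (at \<zeta>)"
  unfolding P_def by (rule derivative_eq_intros refl | simp)+

text \<open>At a multiple root \<open>J_zeta0\<close> would read \<open>S = e0 * T\<close>; the
  signs of both parts then force \<open>r = p = 0\<close>.\<close>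

lemma P'_zeta0: "- 4 * \<zeta>0^3 + 2 * of_real \<omega> * \<zeta>0 + of_real c \<noteq> 0"
proof
  assume "- 4 * \<zeta>0^3 + 2 * of_real \<omega> * \<zeta>0 + of_real c = 0"
  then have "of_real c - 2 * \<zeta>0 * e0 = 0" using zeta0_squared by algebra
  then have "complex_of_real S = e0 * of_real T" using J_zeta0 by simp
  from arg_cong[OF this, of Re] arg_cong[OF this, of Im]
  have "S = - (q * r * T)" "p * (q + r) * T = 0" by (simp_all add: e0_def del: mult_eq_0_iff)
  moreover have "0 < q * r * T" if "r > 0" using that pqr T_pos by simp
  moreover have "0 < p * (q + r) * T" if "p > 0" using that pqr T_pos by (simp add: add_pos_nonneg)
  ultimately show False using r_or_p_pos S_bounds(1) by linarith
qed

end

section \<open>Squared eigenfunctions\<close>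

text \<open>Translation by a period multiplies the eigenfunctions by a unimodular factor, so only
  their norm is periodic. Every value of the norm occurs on the compact interval
  \<open>{0..L}\<close>.\<close>

lemma bounded_range_if_norm_periodic:
  fixes f :: "real \<Rightarrow> complex"
  assumes cont: "continuous_on UNIV f" and "0 < L" and per: "\<And>x. norm (f (x + L)) = norm (f x)"
  shows "bounded (range f)"
proof -
  have nat: "norm (f (x + of_nat n * L)) = norm (f x)" for x n
  proof (induction n)
    case (Suc n)
    have "norm (f (x + of_nat (Suc n) * L)) = norm (f (x + of_nat n * L + L))"
      by (simp add: algebra_simps)
    then show ?case using per Suc by simp
  qed simp
  have "compact (f ` {0..L})"
    by (intro compact_continuous_image continuous_on_subset[OF cont]) auto
  from compact_imp_bounded[OF this] obtain M where "\<forall>z\<in>f ` {0..L}. norm z \<le> M"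
    unfolding bounded_iff by blast
  then have M: "norm (f x) \<le> M" if "x \<in> {0..L}" for x using that by simp
  have "norm (f x) \<le> M" for x
  proof -
    define m where "m = \<lfloor>x / L\<rfloor>"
    define x0 where "x0 = x - of_int m * L"
    have "of_int m \<le> x / L" "x / L < of_int m + 1" unfolding m_def by linarith+
    then have x0: "x0 \<in> {0..L}" using \<open>0 < L\<close> by (auto simp: x0_def field_simps)
    have "norm (f x) = norm (f x0)"
    \<comment> \<open>The shift lemma allows only natural multiples, so for negative
      \<open>m\<close> it is applied starting from \<open>x\<close>.\<close>
    proof (cases "0 \<le> m")
      case True
      then show ?thesis using nat[of x0 "nat m"] by (simp add: x0_def)
    next
      case False
      then show ?thesis using nat[of x "nat (- m)"] by (simp add: x0_def)
    qed
    with M[OF x0] show ?thesis by simp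
  qed
  then show ?thesis by (auto simp: bounded_iff)
qed

lemma continuous_has_antiderivative:
  fixes f :: "real \<Rightarrow> complex"
  assumes "continuous_on UNIV f"
  shows "\<exists>F. \<forall>x. (F has_vector_derivative f x) (at x)"
  using einterval_antiderivative[of "-\<infinity>" "\<infinity>" f] assms
  by (auto simp: continuous_on_eq_continuous_at)

text \<open>\<open>Den_nonzero\<close> keeps \<open>f\<close> free of zeros;
  \<open>Re_Omega_J\<close> makes the Floquet multiplier
  \<open>exp (2 * \<Omega> * J \<zeta>)\<close> unimodular.\<close>

locale spectral_point = elliptic_parameters +
  fixes \<zeta> \<Omega> :: complex
  assumes Omega_squared: "\<Omega>\<^sup>2 = P \<zeta>"
    and Den_nonzero: "\<And>x. Den \<zeta> x \<noteq> 0"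
    and Re_Omega_J: "Re (\<Omega> * J \<zeta>) = 0"
begin

text \<open>\<open>y x = 0\<close> if \<open>R x = 0\<close>, which can happen only if \<open>c = 0\<close>.\<close>

definition y :: "real \<Rightarrow> complex" where "y x = inverse (of_real (R x))"

text \<open>
  In the frame rotating with \<open>\<theta>\<close>, the stationary Lax matrix is \<open>[[A, B], [C, - A]]\<close>. If \<open>(\<psi>1, \<psi>2)\<close> is its
  eigenvector to the eigenvalue \<open>\<Omega>\<close> that also solves the spatial Lax equation, then
  \<open>f = \<psi>1\<^sup>2\<close>, \<open>d = \<psi>1 \<psi>2\<close> and \<open>g = \<psi>2\<^sup>2\<close> solve a linear system with first derivatives \<open>f1\<close>, \<open>d1\<close>, \<open>g1\<close>.
\<close>

definition A :: "real \<Rightarrow> complex" where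
  "A x = \<i> / 2 * ((of_real (R x))\<^sup>2 - 2 * \<zeta>\<^sup>2 + of_real \<omega>)"

definition B :: "real \<Rightarrow> complex" where
  "B x = \<zeta> * of_real (R x) - of_real c * y x / 2 + \<i> * of_real (R' x) / 2"

definition C :: "real \<Rightarrow> complex" where
  "C x = - (\<zeta> * of_real (R x) - of_real c * y x / 2 - \<i> * of_real (R' x) / 2)"

text \<open>Any antiderivative will do: another constant only rescales \<open>f\<close>,
  \<open>d\<close> and \<open>g\<close> together.\<close>

definition H :: "real \<Rightarrow> complex" where
  "H = (SOME F. \<forall>x. (F has_vector_derivative h \<zeta> x) (at x))"

definition E :: "real \<Rightarrow> complex" where "E x = exp (2 * \<Omega> * H x)"

definition d :: "real \<Rightarrow> complex" where "d x = (\<Omega> - A x) * E x"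
definition f :: "real \<Rightarrow> complex" where "f x = B x * E x"
definition g :: "real \<Rightarrow> complex" where "g x = (d x)\<^sup>2 * inverse (f x)"
text \<open>This is \<open>2 * \<zeta> + \<theta>'\<close>; the second term comes from the rotating
  frame.\<close>

definition s :: "real \<Rightarrow> complex" where "s x = 2 * \<zeta> + of_real c * (y x)\<^sup>2"
definition s' :: "real \<Rightarrow> complex" where "s' x = - 2 * of_real c * of_real (R' x) * (y x)^3"
definition d1 :: "real \<Rightarrow> complex" where "d1 x = - of_real (R x) * f x + of_real (R x) * g x"
definition f1 :: "real \<Rightarrow> complex" where "f1 x = - \<i> * s x * f x + 2 * of_real (R x) * d x"
definition g1 :: "real \<Rightarrow> complex" where "g1 x = \<i> * s x * g x - 2 * of_real (R x) * d x"
definition f2 :: "real \<Rightarrow> complex" where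
  "f2 x = - \<i> * s' x * f x - \<i> * s x * f1 x + 2 * of_real (R' x) * d x + 2 * of_real (R x) * d1 x"
definition g2 :: "real \<Rightarrow> complex" where
  "g2 x = \<i> * s' x * g x + \<i> * s x * g1 x - 2 * of_real (R' x) * d x - 2 * of_real (R x) * d1 x"

section \<open>The Lax matrix and the first-order system for \<open>f\<close>, \<open>d\<close>,
  \<open>g\<close>\<close>

lemma c_R_y: "of_real c * of_real (R x) * y x - of_real c = 0"
  using c_eq_0_or_R_nonzero[of x] by (auto simp: y_def)

lemma R'_squared_y:
  "(complex_of_real (R' x))\<^sup>2 = - (of_real (R x) ^ 4) - 2 * of_real \<omega> * (of_real (R x))\<^sup>2 + of_real C1
    - (of_real c)\<^sup>2 * (y x)\<^sup>2"
proof -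
  have "complex_of_real ((R' x)\<^sup>2) = of_real (- ((R x)^4) - 2 * \<omega> * (R x)\<^sup>2 + C1 - c\<^sup>2 / (R x)\<^sup>2)"
    by (rule arg_cong[OF R'_squared])
  then show ?thesis by (simp add: y_def divide_inverse power_inverse)
qed

text \<open>Together with \<open>B_C\<close> this is the characteristic equation
  \<open>\<Omega>\<^sup>2 = A\<^sup>2 + B * C\<close> of the Lax matrix.\<close>

lemma Den_A: "Den \<zeta> x = \<Omega>\<^sup>2 - (A x)\<^sup>2"
  unfolding Den_P A_def Omega_squared R_squared[symmetric]
  by (simp add: power_mult_distrib power_divide)

lemma B_C: "B x * C x = Den \<zeta> x"
  unfolding B_def C_def Den_def R_squared[symmetric] of_real_power
  by (simp add: field_simps) (use R'_squared_y[of x] c_R_y[of x] i_squared in algebra)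

lemma B_nonzero: "B x \<noteq> 0"
  using B_C[of x] Den_nonzero[of x] by auto

text \<open>The numerator of \<open>h\<close> is \<open>R * C\<close> and
  \<open>Den = B * C\<close>, so the nonzero factor \<open>C\<close> cancels.\<close>

lemma h_B: "h \<zeta> x * B x = of_real (R x)"
proof -
  have "- (\<zeta> * of_real (w x) - of_real c / 2 - \<i> * of_real (w' x) / 4) = of_real (R x) * C x"
    unfolding C_def R_squared[symmetric] R_R'[symmetric] of_real_mult of_real_power of_real_numeral
    using c_R_y[of x] by (simp add: field_simps power2_eq_square)
  then have "h \<zeta> x * Den \<zeta> x = of_real (R x) * C x"
    using Den_nonzero[of x] by (simp add: h_def)
  then have "h \<zeta> x * B x * C x = of_real (R x) * C x" by (simp add: mult.assoc B_C)
  moreover have "C x \<noteq> 0" using B_C[of x] Den_nonzero[of x] by auto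
  ultimately show ?thesis by simp
qed

lemma H_deriv: "(H has_vector_derivative h \<zeta> x) (at x)"
  using someI_ex[OF continuous_has_antiderivative[OF continuous_h[OF Den_nonzero]]]
  unfolding H_def by blast

lemma E_deriv: "(E has_vector_derivative 2 * \<Omega> * h \<zeta> x * E x) (at x)"
proof -
  have "((exp \<circ> (\<lambda>x. 2 * \<Omega> * H x)) has_vector_derivative 2 * \<Omega> * h \<zeta> x * exp (2 * \<Omega> * H x)) (at x)"
    by (intro field_vector_diff_chain_at has_vector_derivative_mult_right H_deriv DERIV_exp)
  then show ?thesis by (simp add: o_def E_def[abs_def])
qed

lemma E_nonzero: "E x \<noteq> 0"
  by (simp add: E_def)

lemma f_nonzero: "f x \<noteq> 0"
  by (simp add: f_def E_nonzero B_nonzero)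

lemma R_vderiv: "((\<lambda>x. complex_of_real (R x)) has_vector_derivative of_real (R' x)) (at x)"
  by (intro has_vector_derivative_of_real R_deriv)

text \<open>\<open>y\<close> itself is not differentiable at zeros of \<open>R\<close>, but there
  \<open>c = 0\<close>.\<close>

lemma c_y_deriv:
  "((\<lambda>x. of_real c * y x) has_vector_derivative - of_real c * of_real (R' x) * (y x)\<^sup>2) (at x)"
proof (cases "c = 0")
  case False
  then have "of_real (R x) \<noteq> (0 :: complex)" using c_eq_0_or_R_nonzero by simp
  from has_vector_derivative_mult_right[OF has_vector_derivative_inverse[OF R_vderiv this], of "of_real c"]
  show ?thesis unfolding y_def by (simp add: divide_inverse power_inverse mult.assoc)
qed simp

lemma s_deriv: "(s has_vector_derivative s' x) (at x)"
proof (cases "c = 0")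
  case False
  \<comment> \<open>\<open>c * y\<^sup>2\<close> is written as \<open>(c * y)\<^sup>2 / c\<close> so
    that \<open>c_y_deriv\<close> applies.\<close>
  have "((\<lambda>x. 2 * \<zeta> + (of_real c * y x) * (of_real c * y x) / of_real c) has_vector_derivative
      0 + (of_real c * y x * (- of_real c * of_real (R' x) * (y x)\<^sup>2)
        + - of_real c * of_real (R' x) * (y x)\<^sup>2 * (of_real c * y x)) / of_real c) (at x)"
    by (intro derivative_intros c_y_deriv)
  moreover have "s = (\<lambda>x. 2 * \<zeta> + (of_real c * y x) * (of_real c * y x) / of_real c)"
    using False by (simp add: s_def[abs_def] power2_eq_square mult_ac)
  ultimately show ?thesis
    using False by (simp add: s'_def field_simps power2_eq_square power3_eq_cube)
qed (simp add: s_def[abs_def] s'_def)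

lemma A_deriv: "(A has_vector_derivative \<i> * of_real (R x) * of_real (R' x)) (at x)"
proof -
  have "(A has_vector_derivative \<i> / 2 * ((of_real (R x) * of_real (R' x) + of_real (R' x) * of_real (R x))
      - 0 + 0)) (at x)"
    unfolding A_def[abs_def] power2_eq_square[of "of_real (R _)"] by (intro derivative_intros R_vderiv)
  then show ?thesis by (simp add: mult_ac)
qed

text \<open>Off-diagonal part of the stationary zero-curvature equation, a consequence of
  \<open>R'_deriv\<close>; \<open>A_deriv\<close> is the diagonal part.\<close>

lemma B_deriv: "(B has_vector_derivative - \<i> * s x * B x - 2 * of_real (R x) * A x) (at x)"
proof -
  let ?R = "complex_of_real (R x)" and ?R' = "complex_of_real (R' x)"
  let ?c = "complex_of_real c" and ?\<omega> = "complex_of_real \<omega>"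
  let ?R2 = "of_real (- 2 * (R x)^3 - 2 * \<omega> * R x + c\<^sup>2 / (R x)^3) :: complex"
  have "(B has_vector_derivative \<zeta> * ?R' - (- ?c * ?R' * (y x)\<^sup>2) / 2 + \<i> * ?R2 / 2) (at x)"
    unfolding B_def[abs_def] by (intro derivative_intros R_vderiv c_y_deriv R'_deriv)
  also have "?R2 = - 2 * ?R^3 - 2 * ?\<omega> * ?R + ?c\<^sup>2 * (y x)^3"
    by (simp add: y_def divide_inverse power_inverse)
  also have "\<zeta> * ?R' - (- ?c * ?R' * (y x)\<^sup>2) / 2 + \<i> * (- 2 * ?R^3 - 2 * ?\<omega> * ?R + ?c\<^sup>2 * (y x)^3) / 2
      = - \<i> * s x * B x - 2 * ?R * A x"
    unfolding s_def B_def A_def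
    using c_R_y[of x] i_squared by algebra
  finally show ?thesis .
qed

lemma f_deriv: "(f has_vector_derivative f1 x) (at x)"
proof -
  have "(f has_vector_derivative B x * (2 * \<Omega> * h \<zeta> x * E x)
      + (- \<i> * s x * B x - 2 * of_real (R x) * A x) * E x) (at x)"
    unfolding f_def[abs_def] by (intro derivative_intros B_deriv E_deriv)
  also have "B x * (2 * \<Omega> * h \<zeta> x * E x) = 2 * \<Omega> * of_real (R x) * E x"
    unfolding h_B[of x, symmetric] by algebra
  also have "2 * \<Omega> * of_real (R x) * E x + (- \<i> * s x * B x - 2 * of_real (R x) * A x) * E x = f1 x"
    unfolding f1_def f_def d_def by algebra
  finally show ?thesis .
qed

text \<open>This, \<open>A_d\<close>, \<open>A_g\<close> and \<open>A_f'\<close> are the two rows of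
  the eigenvector equation, each multiplied by \<open>\<psi>1\<close> or
  \<open>\<psi>2\<close>.\<close>

lemma A_f: "(\<Omega> - A x) * f x = B x * d x"
  by (simp add: f_def d_def)

lemma f_g: "f x * g x = (d x)\<^sup>2"
  using f_nonzero[of x] by (simp add: g_def)

lemma A_d: "(\<Omega> - A x) * d x = B x * g x"
proof -
  have "f x * ((\<Omega> - A x) * d x) = f x * (B x * g x)"
    using A_f[of x] f_g[of x] by algebra
  then show ?thesis using f_nonzero[of x] by simp
qed

lemma A_g: "(\<Omega> + A x) * g x = C x * d x"
proof -
  have "B x * ((\<Omega> + A x) * g x) = B x * (C x * d x)"
    using A_d[of x] B_C[of x] Den_A[of x] by algebra
  then show ?thesis using B_nonzero[of x] by simp
qed

lemma A_f': "(\<Omega> + A x) * d x = C x * f x"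
proof -
  have "B x * ((\<Omega> + A x) * d x) = B x * (C x * f x)"
    using A_f[of x] B_C[of x] Den_A[of x] by algebra
  then show ?thesis using B_nonzero[of x] by simp
qed

lemma d_deriv: "(d has_vector_derivative d1 x) (at x)"
proof -
  let ?R = "complex_of_real (R x)" and ?R' = "complex_of_real (R' x)"
  have "(d has_vector_derivative (\<Omega> - A x) * (2 * \<Omega> * h \<zeta> x * E x) + (0 - \<i> * ?R * ?R') * E x) (at x)"
    unfolding d_def[abs_def] by (intro derivative_intros A_deriv E_deriv)
  \<comment> \<open>Multiplying by the nonzero \<open>B\<close> replaces \<open>h * B\<close> by
    \<open>R\<close> and lets the eigenvector relations act.\<close>
  moreover have "B x * ((\<Omega> - A x) * (2 * \<Omega> * h \<zeta> x * E x) + (0 - \<i> * ?R * ?R') * E x) = B x * d1 x"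
  proof -
    have BC: "B x + C x = \<i> * ?R'" by (simp add: B_def C_def)
    have "B x * ((\<Omega> - A x) * (2 * \<Omega> * h \<zeta> x * E x) + (0 - \<i> * ?R * ?R') * E x)
        = 2 * \<Omega> * (h \<zeta> x * B x) * d x - \<i> * ?R' * ?R * f x"
      unfolding d_def f_def by algebra
    also have "\<dots> = 2 * \<Omega> * ?R * d x - (B x + C x) * ?R * f x" unfolding h_B BC ..
    also have "\<dots> = B x * d1 x"
      unfolding d1_def using A_d[of x] A_f'[of x] by algebra
    finally show ?thesis .
  qed
  ultimately show ?thesis using B_nonzero[of x] by simp
qed

lemma g_deriv: "(g has_vector_derivative g1 x) (at x)"
proof -
  have "(g has_vector_derivative d x * d x * (- f1 x / (f x)\<^sup>2) + (d x * d1 x + d1 x * d x) * inverse (f x)) (at x)"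
    unfolding g_def[abs_def] power2_eq_square[of "d _"]
    by (intro derivative_intros d_deriv has_vector_derivative_inverse f_deriv f_nonzero)
  also have "d x * d x * (- f1 x / (f x)\<^sup>2) + (d x * d1 x + d1 x * d x) * inverse (f x)
      = (2 * d x * d1 x * f x - (d x)\<^sup>2 * f1 x) / (f x)\<^sup>2"
    using f_nonzero[of x] by (simp add: field_simps power2_eq_square)
  also have "2 * d x * d1 x * f x - (d x)\<^sup>2 * f1 x = g1 x * (f x)\<^sup>2"
    unfolding d1_def f1_def g1_def using f_g[of x] by algebra
  finally show ?thesis using f_nonzero[of x] by simp
qed

lemma f1_deriv: "(f1 has_vector_derivative f2 x) (at x)"
proof -
  have "(f1 has_vector_derivative
      (- \<i> * s x) * f1 x + (- \<i> * s' x) * f x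
      + ((2 * of_real (R x)) * d1 x + (2 * of_real (R' x)) * d x)) (at x)"
    unfolding f1_def[abs_def]
    by (intro derivative_intros f_deriv[unfolded f1_def] d_deriv s_deriv R_vderiv)
  also have "(- \<i> * s x) * f1 x + (- \<i> * s' x) * f x
      + ((2 * of_real (R x)) * d1 x + (2 * of_real (R' x)) * d x) = f2 x"
    unfolding f2_def by algebra
  finally show ?thesis .
qed

lemma g1_deriv: "(g1 has_vector_derivative g2 x) (at x)"
proof -
  have "(g1 has_vector_derivative
      (\<i> * s x) * g1 x + (\<i> * s' x) * g x
      - ((2 * of_real (R x)) * d1 x + (2 * of_real (R' x)) * d x)) (at x)"
    unfolding g1_def[abs_def]
    by (intro derivative_intros g_deriv[unfolded g1_def] d_deriv s_deriv R_vderiv)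
  also have "(\<i> * s x) * g1 x + (\<i> * s' x) * g x
      - ((2 * of_real (R x)) * d1 x + (2 * of_real (R' x)) * d x) = g2 x"
    unfolding g2_def by algebra
  finally show ?thesis .
qed

text \<open>\<open>2 * A * f + 2 * B * d\<close> is the temporal Lax flow of
  \<open>\<psi>1\<^sup>2\<close>. The right side is the linearization for
  \<open>u + i v = f\<close>, \<open>u - i v = - g\<close>; \<open>g_equation\<close> is the
  companion for \<open>\<psi>2\<^sup>2\<close>.\<close>

lemma f_equation:
  "2 * \<Omega> * f x = - (of_real c * (y x)\<^sup>2 * f1 x - of_real c * of_real (R' x) * (y x)^3 * f x)
    - \<i> * (- f2 x / 2 - of_real \<omega> * f x + (of_real c)\<^sup>2 * (y x)^4 / 2 * f x
        - 2 * (of_real (R x))\<^sup>2 * f x + (of_real (R x))\<^sup>2 * g x)"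
proof -
  have "2 * \<Omega> * f x = 2 * A x * f x + 2 * B x * d x" using A_f[of x] by algebra
  also have "\<dots> = - (of_real c * (y x)\<^sup>2 * f1 x - of_real c * of_real (R' x) * (y x)^3 * f x)
    - \<i> * (- f2 x / 2 - of_real \<omega> * f x + (of_real c)\<^sup>2 * (y x)^4 / 2 * f x
        - 2 * (of_real (R x))\<^sup>2 * f x + (of_real (R x))\<^sup>2 * g x)"
    unfolding f2_def f1_def d1_def s_def s'_def A_def B_def
    using c_R_y[of x] i_squared by algebra
  finally show ?thesis .
qed

lemma g_equation:
  "2 * \<Omega> * g x = - (of_real c * (y x)\<^sup>2 * g1 x - of_real c * of_real (R' x) * (y x)^3 * g x)
    + \<i> * (- g2 x / 2 - of_real \<omega> * g x + (of_real c)\<^sup>2 * (y x)^4 / 2 * g x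
        - 2 * (of_real (R x))\<^sup>2 * g x + (of_real (R x))\<^sup>2 * f x)"
proof -
  have "2 * \<Omega> * g x = - 2 * A x * g x + 2 * C x * d x" using A_g[of x] by algebra
  also have "\<dots> = - (of_real c * (y x)\<^sup>2 * g1 x - of_real c * of_real (R' x) * (y x)^3 * g x)
    + \<i> * (- g2 x / 2 - of_real \<omega> * g x + (of_real c)\<^sup>2 * (y x)^4 / 2 * g x
        - 2 * (of_real (R x))\<^sup>2 * g x + (of_real (R x))\<^sup>2 * f x)"
    unfolding g2_def g1_def d1_def s_def s'_def A_def C_def
    using c_R_y[of x] i_squared by algebra
  finally show ?thesis .
qed

end

section \<open>Boundedness and membership in the spectrum\<close>

context spectral_point
begin

lemma h_periodic: "h \<zeta> (x + T) = h \<zeta> x"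
  by (simp add: h_def Den_def periodic)

text \<open>\<open>H (x + T) - H x\<close> is constant because \<open>h\<close> is periodic, and its
  value is \<open>J \<zeta>\<close>; hence \<open>E\<close> picks up a unimodular factor.\<close>

lemma norm_E_periodic: "norm (E (x + T)) = norm (E x)"
proof -
  have "((\<lambda>x. H (x + T) - H x) has_vector_derivative h \<zeta> (x + T) - h \<zeta> x) (at x)" for x
  proof -
    have "((H \<circ> (\<lambda>x. x + T)) has_vector_derivative 1 *\<^sub>R h \<zeta> (x + T)) (at x)"
      by (rule vector_diff_chain_at[OF _ H_deriv]) (auto intro!: derivative_eq_intros)
    then show ?thesis by (intro has_vector_derivative_diff H_deriv) (simp add: o_def)
  qed
  then have "((\<lambda>x. H (x + T) - H x) has_vector_derivative 0) (at x within UNIV)" for x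
    by (simp add: h_periodic)
  then obtain a where a: "H (x + T) - H x = a" for x
    using has_vector_derivative_zero_constant[of UNIV "\<lambda>x. H (x + T) - H x"] by auto
  have "(h \<zeta> has_integral H T - H 0) {0..T}"
    by (rule fundamental_theorem_of_calculus)
      (use T_pos in simp, rule has_vector_derivative_at_within[OF H_deriv])
  then have "J \<zeta> = a" using a[of 0] by (simp add: J_def integral_unique)
  then have "H (x + T) = H x + J \<zeta>" using a[of x] by (simp add: algebra_simps)
  then have "E (x + T) = E x * exp (2 * (\<Omega> * J \<zeta>))"
    by (simp add: E_def ring_distribs exp_add mult_ac)
  then show ?thesis using Re_Omega_J by (simp add: norm_mult)
qed

lemma bounded_f_g: "bounded (range f)" "bounded (range g)"
proof -
  have per: "A (x + T) = A x" "B (x + T) = B x" for x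
    by (simp_all add: A_def B_def y_def periodic)
  have f: "norm (f (x + T)) = norm (f x)" for x
    by (simp add: f_def norm_mult per norm_E_periodic)
  then have "norm (g (x + T)) = norm (g x)" for x
    by (simp add: g_def d_def norm_mult norm_power norm_inverse per norm_E_periodic)
  moreover have "continuous_on UNIV f" "continuous_on UNIV g"
    by (meson continuous_at_imp_continuous_on f_deriv g_deriv has_vector_derivative_continuous)+
  ultimately show "bounded (range f)" "bounded (range g)"
    using bounded_range_if_norm_periodic T_pos f by blast+
qed

lemma spectrum: "2 * \<Omega> \<in> stability_spectrum k b"
proof -
  \<comment> \<open>\<open>u + i v = \<psi>1\<^sup>2\<close> and \<open>u - i v = - \<psi>2\<^sup>2\<close>, the complex conjugation in the equation being dropped\<close>
  define U where "U = (\<lambda>x. (f x - g x) / 2)"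
  define V where "V = (\<lambda>x. - \<i> / 2 * (f x + g x))"
  let ?U1 = "\<lambda>x. (f1 x - g1 x) / 2" and ?U2 = "\<lambda>x. (f2 x - g2 x) / 2"
  let ?V1 = "\<lambda>x. - \<i> / 2 * (f1 x + g1 x)" and ?V2 = "\<lambda>x. - \<i> / 2 * (f2 x + g2 x)"
  have U1: "(U has_vector_derivative ?U1 x) (at x)" and U2: "(?U1 has_vector_derivative ?U2 x) (at x)"
    and V1: "(V has_vector_derivative ?V1 x) (at x)" and V2: "(?V1 has_vector_derivative ?V2 x) (at x)" for x
    unfolding U_def V_def by (intro derivative_intros f_deriv g_deriv f1_deriv g1_deriv)+
  have DU: "Dx U x = ?U1 x" "Dx ?U1 x = ?U2 x" and DV: "Dx V x = ?V1 x" "Dx ?V1 x = ?V2 x" for x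
    by (rule vector_derivative_at, rule U1 U2 V1 V2)+
  have "twice_differentiable U" "twice_differentiable V"
    unfolding twice_differentiable_def DU(1) DV(1) differentiable_on_def
    by (intro conjI ballI differentiableI_vector[OF U1] differentiableI_vector[OF U2]
        differentiableI_vector[OF V1] differentiableI_vector[OF V2])+
  moreover have "bounded (range U)" "bounded (range V)"
  proof -
    obtain M N where MN: "\<And>x. norm (f x) \<le> M" "\<And>x. norm (g x) \<le> N"
      using bounded_f_g by (auto simp: bounded_iff)
    define K where "K = (M + N) / 2"
    have "norm (f x - g x) \<le> K * 2" "norm (f x + g x) \<le> K * 2" for x
      using norm_triangle_ineq4[of "f x" "g x"] norm_triangle_ineq[of "f x" "g x"] MN(1)[of x] MN(2)[of x]
      by (simp_all add: K_def)
    then show "bounded (range U)" "bounded (range V)"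
      unfolding bounded_iff U_def V_def
      by (auto simp: norm_mult norm_divide intro!: exI[of _ K])
  qed
  moreover have "(U, V) \<noteq> (\<lambda>x. 0, \<lambda>x. 0)"
  proof
    assume "(U, V) = (\<lambda>x. 0, \<lambda>x. 0)"
    then have "U 0 + \<i> * V 0 = 0" by simp
    moreover have "U 0 + \<i> * V 0 = f 0" by (simp add: U_def V_def field_simps)
    ultimately show False using f_nonzero by simp
  qed
  moreover have "linearization k b (U, V) = (\<lambda>x. 2 * \<Omega> * U x, \<lambda>x. 2 * \<Omega> * V x)"
  proof -
    have dR: "deriv R x = R' x" for x by (rule DERIV_imp_deriv[OF R_deriv])
    \<comment> \<open>Division by zero gives 0, so powers of \<open>y\<close> replace the quotients
      even at zeros of \<open>R\<close>.\<close>
    have S: "S_op k b F x = of_real c * (y x)\<^sup>2 * Dx F x - of_real c * of_real (R' x) * (y x)^3 * F x" for F x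
      by (simp add: S_op_def dR y_def divide_inverse power_inverse)
    have y4: "complex_of_real c ^ 2 / (2 * complex_of_real (R x) ^ 4) = (of_real c)\<^sup>2 * (y x)^4 / 2" for x
      by (simp add: y_def inverse_eq_divide power_divide)
    have Lm: "L_minus k b F x = - Dx (Dx F) x / 2 + (- (of_real (R x))\<^sup>2 - of_real \<omega>
        + (of_real c)\<^sup>2 * (y x)^4 / 2) * F x" for F x
      by (simp add: L_minus_def y4)
    have Lp: "L_plus k b F x = - Dx (Dx F) x / 2 + (- 3 * (of_real (R x))\<^sup>2 - of_real \<omega>
        + (of_real c)\<^sup>2 * (y x)^4 / 2) * F x" for F x
      by (simp add: L_plus_def y4)
    have "- S_op k b U x + L_minus k b V x = 2 * \<Omega> * U x" for x
    proof -
      have eq: "2 * \<Omega> * U x = (2 * \<Omega> * f x - 2 * \<Omega> * g x) / 2"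
        by (simp add: U_def algebra_simps)
      show ?thesis
        unfolding eq f_equation g_equation S Lm DU DV unfolding U_def V_def by (simp add: field_simps)
    qed
    moreover have "- L_plus k b U x - S_op k b V x = 2 * \<Omega> * V x" for x
    proof -
      have eq: "2 * \<Omega> * V x = - \<i> / 2 * (2 * \<Omega> * f x + 2 * \<Omega> * g x)"
        by (simp add: V_def algebra_simps)
      show ?thesis
        unfolding eq f_equation g_equation S Lp DU DV unfolding U_def V_def by (simp add: field_simps)
    qed
    ultimately show ?thesis by (simp add: linearization_def)
  qed
  ultimately show ?thesis unfolding stability_spectrum_def by blast
qed

end

text \<open>
  By the open mapping theorem \<open>P J\<^sup>2\<close> attains \<open>- t\<^sup>2\<close> for small \<open>t\<close>; take \<open>\<Omega> = \<plusminus> i t / J z\<close>.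
\<close>

lemma imaginary_product_root:
  fixes P J :: "complex \<Rightarrow> complex"
  assumes "open S" "z0 \<in> S" and P: "P holomorphic_on S" and J: "J holomorphic_on S"
    and "P z0 = 0" "(P has_field_derivative D) (at z0)" "D \<noteq> 0" "Im (J z0) \<noteq> 0" "0 < \<epsilon>"
  obtains z \<Omega> where "z \<in> S" "\<Omega>\<^sup>2 = P z" "Re (\<Omega> * J z) = 0" "0 < Re \<Omega>" "norm \<Omega> < \<epsilon>"
proof -
  have cont: "continuous_on S P" "continuous_on S J"
    using P J by (auto intro: holomorphic_on_imp_continuous_on)
  have "open {z \<in> S. Im (J z) \<noteq> 0 \<and> norm (P z) < \<epsilon>\<^sup>2}"
  proof -
    have "open (S \<inter> (\<lambda>z. Im (J z)) -` (- {0}))" "open (S \<inter> (\<lambda>z. norm (P z)) -` {..<\<epsilon>\<^sup>2})"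
      by (intro continuous_open_preimage continuous_intros cont assms(1); simp)+
    moreover have "{z \<in> S. Im (J z) \<noteq> 0 \<and> norm (P z) < \<epsilon>\<^sup>2}
        = (S \<inter> (\<lambda>z. Im (J z)) -` (- {0})) \<inter> (S \<inter> (\<lambda>z. norm (P z)) -` {..<\<epsilon>\<^sup>2})"
      by auto
    ultimately show ?thesis by auto
  qed
  moreover have "z0 \<in> {z \<in> S. Im (J z) \<noteq> 0 \<and> norm (P z) < \<epsilon>\<^sup>2}" using assms by simp
  ultimately obtain \<delta> where \<delta>: "0 < \<delta>" "ball z0 \<delta> \<subseteq> {z \<in> S. Im (J z) \<noteq> 0 \<and> norm (P z) < \<epsilon>\<^sup>2}"
    by (meson openE)
  let ?B = "ball z0 \<delta>"
  define F where "F = (\<lambda>z. P z * (J z)\<^sup>2)"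
  have "F holomorphic_on ?B"
    unfolding F_def using \<delta>(2) by (intro holomorphic_intros holomorphic_on_subset[OF P] holomorphic_on_subset[OF J]) auto
  \<comment> \<open>On \<open>?B\<close> the function \<open>J\<close> has no zero, so a constant
    \<open>F\<close> would make \<open>P\<close> vanish identically, against
    \<open>D \<noteq> 0\<close>.\<close>
  moreover have "\<not> F constant_on ?B"
  proof
    assume "F constant_on ?B"
    then have "F z = F z0" if "z \<in> ?B" for z
      using that \<delta>(1) by (metis centre_in_ball constant_on_def)
    then have P0: "P z = 0" if "z \<in> ?B" for z
      using that \<delta>(2) \<open>P z0 = 0\<close> by (fastforce simp: F_def)
    have "(P has_field_derivative 0) (at z0)"
      by (rule has_field_derivative_transform_within_open[of "\<lambda>_. 0" 0 z0 ?B])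
        (use P0 \<delta>(1) in auto)
    with assms(6,7) show False using DERIV_unique by blast
  qed
  ultimately have "open (F ` ?B)" by (intro open_mapping_thm[of F ?B]) auto
  moreover have "0 \<in> F ` ?B" using \<delta>(1) \<open>P z0 = 0\<close> by (auto simp: F_def image_iff intro!: bexI[of _ z0])
  ultimately obtain \<rho> where \<rho>: "0 < \<rho>" "ball 0 \<rho> \<subseteq> F ` ?B" by (meson openE)
  define t where "t = sqrt (\<rho> / 2)"
  have "0 < t" "t\<^sup>2 = \<rho> / 2" using \<rho>(1) by (simp_all add: t_def)
  then have "- (of_real t)\<^sup>2 \<in> ball (0 :: complex) \<rho>" using \<rho>(1) by (simp add: norm_power)
  then obtain z where z: "z \<in> ?B" "P z * (J z)\<^sup>2 = - (of_real t)\<^sup>2"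
    using \<rho>(2) unfolding F_def by (metis (no_types, lifting) imageE subsetD)
  then have ImJ: "Im (J z) \<noteq> 0" and "z \<in> S" and "norm (P z) < \<epsilon>\<^sup>2" using \<delta>(2) by auto
  \<comment> \<open>\<open>Re (\<i> / J z)\<close> has the sign of \<open>Im (J z)\<close>, which
    the factor \<open>sgn\<close> compensates.\<close>
  define \<Omega> where "\<Omega> = \<i> * of_real (sgn (Im (J z)) * t) / J z"
  have J0: "J z \<noteq> 0" using ImJ by auto
  have sgn: "(sgn (Im (J z)))\<^sup>2 = 1" using ImJ by (auto simp: sgn_if)
  have "\<Omega>\<^sup>2 * (J z)\<^sup>2 = - (of_real ((sgn (Im (J z)))\<^sup>2 * t\<^sup>2))"
    using J0 by (simp add: \<Omega>_def power_divide power_mult_distrib)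
  also have "\<dots> = P z * (J z)\<^sup>2" unfolding sgn z(2) by simp
  finally have Om: "\<Omega>\<^sup>2 = P z" using J0 by simp
  have "Re \<Omega> = sgn (Im (J z)) * t * Im (J z) / (norm (J z))\<^sup>2"
    by (simp add: \<Omega>_def Re_divide cmod_power2)
  also have "\<dots> = \<bar>Im (J z)\<bar> * t / (norm (J z))\<^sup>2" by (simp add: abs_sgn mult_ac)
  finally have "0 < Re \<Omega>" using ImJ J0 \<open>0 < t\<close> by simp
  moreover have "Re (\<Omega> * J z) = 0" using J0 by (simp add: \<Omega>_def)
  moreover have "norm \<Omega> < \<epsilon>"
  proof -
    have "(norm \<Omega>)\<^sup>2 < \<epsilon>\<^sup>2" using \<open>norm (P z) < \<epsilon>\<^sup>2\<close> by (simp flip: Om add: norm_power)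
    then show ?thesis using \<open>0 < \<epsilon>\<close> by (simp add: power_less_imp_less_base)
  qed
  ultimately show ?thesis using that[OF \<open>z \<in> S\<close> Om] by blast
qed

section \<open>Unstable spectrum near the origin\<close>

lemma (in elliptic_parameters) unstable_spectrum_near_origin:
  assumes "0 < \<epsilon>"
  shows "\<exists>\<mu>\<in>stability_spectrum k b. norm \<mu> < \<epsilon> \<and> Re \<mu> > 0"
proof -
  obtain N where N: "open N" "\<zeta>0 \<in> N" "\<And>\<zeta> x. \<zeta> \<in> N \<Longrightarrow> Den \<zeta> x \<noteq> 0"
    using Den_nonzero_nbhd by blast
  \<comment> \<open>A ball is taken because \<open>J_holomorphic\<close> asks for a convex
    set.\<close>
  obtain \<delta> where \<delta>: "0 < \<delta>" "ball \<zeta>0 \<delta> \<subseteq> N" using N(1,2) by (meson openE)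
  have Den: "Den \<zeta> x \<noteq> 0" if "\<zeta> \<in> ball \<zeta>0 \<delta>" for \<zeta> x using that \<delta>(2) N(3) by blast
  have "P holomorphic_on ball \<zeta>0 \<delta>"
    unfolding P_def by (intro holomorphic_intros)
  moreover have "J holomorphic_on ball \<zeta>0 \<delta>"
    by (rule J_holomorphic[OF Den convex_ball])
  \<comment> \<open>The bound is \<open>\<epsilon> / 2\<close> because the spectral value is
    \<open>2 * \<Omega>\<close>.\<close>
  ultimately obtain \<zeta> \<Omega> where z: "\<zeta> \<in> ball \<zeta>0 \<delta>" "\<Omega>\<^sup>2 = P \<zeta>" "Re (\<Omega> * J \<zeta>) = 0" "0 < Re \<Omega>"
    "norm \<Omega> < \<epsilon> / 2"
    using imaginary_product_root[of "ball \<zeta>0 \<delta>" \<zeta>0 P J _ "\<epsilon> / 2"] P_zeta0 P_deriv P'_zeta0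
      Im_J_zeta0 \<delta>(1) assms by (metis centre_in_ball half_gt_zero open_ball)
  interpret spectral_point k b \<zeta> \<Omega>
    by unfold_locales (use z Den in auto)
  show ?thesis
    using spectrum z(4,5) by (intro bexI[of _ "2 * \<Omega>"]) (auto simp: norm_mult)
qed

theorem mainTheorem1:
  fixes k b :: real and \<phi> :: "real \<Rightarrow> complex"
  assumes "0 \<le> k" and "k < 1" and "k\<^sup>2 \<le> b" and "b \<le> 1"
    and "\<phi> = elliptic_solution k b" and "\<phi> \<noteq> (\<lambda>x. 0)"
  shows "\<not> spectrally_stable k b \<and>
    (\<forall>\<epsilon>>0. \<exists>\<mu>\<in>stability_spectrum k b. norm \<mu> < \<epsilon> \<and> Re \<mu> > 0)"
proof -
  \<comment> \<open>\<open>b = 0\<close> forces \<open>k = 0\<close>, the zero solution.\<close>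
  have "b \<noteq> 0"
    using assms elliptic_solution_eq_0_iff[of k b] by auto
  moreover have "0 \<le> b" using assms(3) by (rule order_trans[OF zero_le_power2])
  ultimately interpret elliptic_parameters k b
    using assms by unfold_locales auto
  have "\<forall>\<epsilon>>0. \<exists>\<mu>\<in>stability_spectrum k b. norm \<mu> < \<epsilon> \<and> Re \<mu> > 0"
    using unstable_spectrum_near_origin by blast
  moreover from this have "\<not> spectrally_stable k b"
    unfolding spectrally_stable_def by (metis (mono_tags, lifting) IntI empty_iff mem_Collect_eq zero_less_one)
  ultimately show ?thesis by blast
qed

end
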